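(* Fix an integer $k\ge1$ and let $H_n^k$ be the length of the longest monotone subsequence in a uniformly random element of $L_n^k$. Then $E[H_n^k]=\Theta(n^{\frac{k}{k+1}})$, and $H_n^k=\Theta_k(n^{\frac{k}{k+1}})$ asymptotically almost surely (i.e., there are constants $0<a_k<b_k$ such that $\Pr[a_k n^{k/(k+1)}\le H_n^k\le b_k n^{k/(k+1)}]\to1$ as $n\to\infty$).
   Context: An order-$n$ $k$-dimensional permutation is an array $A:[n]^{k+1}\to\{0,1\}$ such that every line contains exactly one $1$, where a line is the set of positions obtained by fixing $k$ of the $k+1$ coordinates and letting the remaining coordinate range over $[n]$. $L_n^k$ denotes the set of all such arrays. The support of $A$ is $G_A=\{\alpha\in[n]^{k+1}:A(\alpha)=1\}$. A monotone subsequence of length $m$ in $A$ is a sequence $\alpha^1,\dots,\alpha^m\in G_A$ such that for every coordinate $1\le j\le k+1$ the sequence $\alpha^1_j,\dots,\alpha^m_j$ is strictly monotone (the direction may depend on $j$). Asymptotics are as $n\to\infty$ with $k$ fixed. *)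

theory Defs
  imports "HOL-Probability.Probability" "HOL-Library.Landau_Symbols"
begin

text \<open>
  The set \<open>[n]\<^sup>k\<^sup>+\<^sup>1\<close> is the extensional function space from the coordinates
  \<open>{1..k+1}\<close> to \<open>{1..n}\<close>; arrays are likewise extensional, so that distinct elements of
  \<open>hd_permutations\<close> are distinct as arrays and the uniform distribution counts each array once.
\<close>

definition positions :: "nat \<Rightarrow> nat \<Rightarrow> (nat \<Rightarrow> nat) set" where
  "positions k n = {1..k+1} \<rightarrow>\<^sub>E {1..n}"

definition line :: "nat \<Rightarrow> nat \<Rightarrow> nat \<Rightarrow> (nat \<Rightarrow> nat) \<Rightarrow> (nat \<Rightarrow> nat) set" where
  "line k n j \<alpha> = {\<beta> \<in> positions k n. \<forall>i \<in> {1..k+1} - {j}. \<beta> i = \<alpha> i}"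

definition lines :: "nat \<Rightarrow> nat \<Rightarrow> (nat \<Rightarrow> nat) set set" where
  "lines k n = {line k n j \<alpha> | j \<alpha>. j \<in> {1..k+1} \<and> \<alpha> \<in> positions k n}"

definition hd_permutations :: "nat \<Rightarrow> nat \<Rightarrow> ((nat \<Rightarrow> nat) \<Rightarrow> nat) set" where
  "hd_permutations k n =
    {A \<in> positions k n \<rightarrow>\<^sub>E {0, 1}. \<forall>l \<in> lines k n. \<exists>!\<alpha>. \<alpha> \<in> l \<and> A \<alpha> = 1}"

definition support :: "nat \<Rightarrow> nat \<Rightarrow> ((nat \<Rightarrow> nat) \<Rightarrow> nat) \<Rightarrow> (nat \<Rightarrow> nat) set" where
  "support k n A = {\<alpha> \<in> positions k n. A \<alpha> = 1}"

definition monotone_subsequence ::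
    "nat \<Rightarrow> nat \<Rightarrow> ((nat \<Rightarrow> nat) \<Rightarrow> nat) \<Rightarrow> (nat \<Rightarrow> nat) list \<Rightarrow> bool" where
  "monotone_subsequence k n A s \<longleftrightarrow>
    set s \<subseteq> support k n A \<and>
    (\<forall>j \<in> {1..k+1}. sorted_wrt (<) (map (\<lambda>\<alpha>. \<alpha> j) s) \<or> sorted_wrt (>) (map (\<lambda>\<alpha>. \<alpha> j) s))"

definition longest_monotone :: "nat \<Rightarrow> nat \<Rightarrow> ((nat \<Rightarrow> nat) \<Rightarrow> nat) \<Rightarrow> nat" where
  "longest_monotone k n A = Max {length s | s. monotone_subsequence k n A s}"

definition random_hd_permutation :: "nat \<Rightarrow> nat \<Rightarrow> ((nat \<Rightarrow> nat) \<Rightarrow> nat) pmf" where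
  "random_hd_permutation k n = pmf_of_set (hd_permutations k n)"

text \<open>
  The maximum and the uniform distribution above are well defined: the following lemmas supply
  the finiteness and nonemptiness conditions of \<^const>\<open>Max\<close> and \<^const>\<open>pmf_of_set\<close>.
\<close>

lemma finite_positions: "finite (positions k n)"
  unfolding positions_def by (intro finite_PiE) auto

lemma finite_hd_permutations: "finite (hd_permutations k n)"
proof (rule finite_subset)
  show "hd_permutations k n \<subseteq> positions k n \<rightarrow>\<^sub>E {0, 1}"
    unfolding hd_permutations_def by blast
  show "finite (positions k n \<rightarrow>\<^sub>E {0, 1 :: nat})"
    by (intro finite_PiE finite_positions) auto
qed

lemma hd_permutations_nonempty: "hd_permutations k n \<noteq> {}"
proof -
  define A :: "(nat \<Rightarrow> nat) \<Rightarrow> nat" where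
    "A = restrict (\<lambda>\<alpha>. if n dvd (\<Sum>i\<in>{1..k+1}. \<alpha> i) then 1 else 0) (positions k n)"
  have "\<exists>!\<gamma>. \<gamma> \<in> line k n j \<alpha> \<and> A \<gamma> = 1"
    if j: "j \<in> {1..k+1}" and \<alpha>: "\<alpha> \<in> positions k n" for j \<alpha>
  proof -
    define S where "S = (\<Sum>i\<in>{1..k+1} - {j}. \<alpha> i)"
    have n: "n > 0"
      using PiE_mem[OF \<alpha>[unfolded positions_def] j] by simp
    have sum: "(\<Sum>i\<in>{1..k+1}. \<beta> i) = \<beta> j + S" if "\<beta> \<in> line k n j \<alpha>" for \<beta>
    proof -
      have "(\<Sum>i\<in>{1..k+1} - {j}. \<beta> i) = S"
        unfolding S_def using that by (intro sum.cong) (auto simp: line_def)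
      then show ?thesis using sum.remove[OF finite_atLeastAtMost j, of \<beta>] by (simp only:)
    qed
    define v where "v = n - S mod n"
    have v: "v \<in> {1..n}" using n by (auto simp: v_def Suc_le_eq)
    have dv: "n dvd v + S"
    proof -
      have "v + S mod n = n" using n by (simp add: v_def less_imp_le)
      then have "(v + S) mod n = 0" using mod_add_right_eq[of v S n] by simp
      then show ?thesis by (simp only: mod_eq_0_iff_dvd)
    qed
    define \<gamma> where "\<gamma> = \<alpha>(j := v)"
    have \<gamma>pos: "\<gamma> \<in> positions k n"
      using \<alpha> v j unfolding positions_def \<gamma>_def by (auto simp: PiE_iff extensional_def)
    have \<gamma>line: "\<gamma> \<in> line k n j \<alpha>"
      using \<gamma>pos unfolding line_def by (auto simp: \<gamma>_def)
    have A\<gamma>: "A \<gamma> = 1"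
    proof -
      have "n dvd (\<Sum>i\<in>{1..k+1}. \<gamma> i)"
        using dv by (simp only: sum[OF \<gamma>line]) (simp add: \<gamma>_def)
      then show ?thesis using \<gamma>pos by (simp only: A_def restrict_def if_True)
    qed
    show ?thesis
    proof (rule ex1I[of _ \<gamma>])
      show "\<gamma> \<in> line k n j \<alpha> \<and> A \<gamma> = 1" using \<gamma>line A\<gamma> by blast
    next
      fix \<beta> assume \<beta>: "\<beta> \<in> line k n j \<alpha> \<and> A \<beta> = 1"
      then have \<beta>pos: "\<beta> \<in> positions k n" by (simp add: line_def)
      have "n dvd (\<Sum>i\<in>{1..k+1}. \<beta> i)"
      proof (rule ccontr)
        assume "\<not> ?thesis"
        then have "A \<beta> = 0" using \<beta>pos by (simp only: A_def restrict_def if_True if_False)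
        then show False using \<beta> by simp
      qed
      then have d\<beta>: "n dvd \<beta> j + S" using sum \<beta> by (simp only:)
      have bj: "\<beta> j \<in> {1..n}" using \<beta>pos j unfolding positions_def by (rule PiE_mem)
      have "int n dvd int (\<beta> j + S) - int (v + S)"
        using d\<beta> dv by (intro dvd_diff) (simp_all only: int_dvd_int_iff)
      then have "int n dvd int (\<beta> j) - int v" by simp
      moreover have "\<bar>int (\<beta> j) - int v\<bar> < int n" using bj v by auto
      ultimately have "int (\<beta> j) - int v = 0"
        using dvd_imp_le_int[of "int (\<beta> j) - int v" "int n"] by linarith
      then have "\<beta> j = v" by simp
      show "\<beta> = \<gamma>"
      proof
        fix i
        show "\<beta> i = \<gamma> i"
        proof (cases "i \<in> {1..k+1}")
          case True
          then show ?thesis using \<beta> \<open>\<beta> j = v\<close> by (auto simp: line_def \<gamma>_def)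
        next
          case False
          then show ?thesis
            using PiE_arb[OF \<beta>pos[unfolded positions_def]] PiE_arb[OF \<gamma>pos[unfolded positions_def]]
            by simp
        qed
      qed
    qed
  qed
  moreover have "A \<in> positions k n \<rightarrow>\<^sub>E {0, 1}"
    unfolding A_def by auto
  ultimately have "A \<in> hd_permutations k n"
    unfolding hd_permutations_def lines_def by blast
  then show ?thesis by blast
qed

lemma monotone_subsequence_Nil: "monotone_subsequence k n A []"
  by (simp add: monotone_subsequence_def)

lemma length_monotone_subsequence_le:
  assumes "monotone_subsequence k n A s"
  shows "length s \<le> n"
proof -
  let ?xs = "map (\<lambda>\<alpha>. \<alpha> 1) s"
  have "sorted_wrt (<) ?xs \<or> sorted_wrt (>) ?xs"
    using assms by (auto simp: monotone_subsequence_def)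
  then have "distinct ?xs"
  proof
    assume "sorted_wrt (>) ?xs"
    then have "sorted_wrt (<) (rev ?xs)" by (simp add: sorted_wrt_rev)
    then show ?thesis using strict_sorted_iff distinct_rev by blast
  qed (use strict_sorted_iff in blast)
  moreover have "set ?xs \<subseteq> {1..n}"
  proof
    fix x assume "x \<in> set ?xs"
    then obtain \<alpha> where \<alpha>: "\<alpha> \<in> set s" "x = \<alpha> 1" by auto
    then have "\<alpha> \<in> positions k n" using assms by (auto simp: monotone_subsequence_def support_def)
    then have "\<alpha> 1 \<in> {1..n}" unfolding positions_def by (rule PiE_mem) simp
    then show "x \<in> {1..n}" using \<alpha> by simp
  qed
  ultimately show ?thesis
    using distinct_card[of ?xs] card_mono[of "{1..n}" "set ?xs"] by simp
qed

lemma finite_monotone_lengths: "finite {length s | s. monotone_subsequence k n A s}"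
  by (rule finite_subset[of _ "{..n}"]) (auto dest: length_monotone_subsequence_le)

end

theory Submission
  imports Defs "HOL-Real_Asymp.Real_Asymp"
begin

text \<open>
  Permuting the values of each coordinate separately maps the set of arrays to itself, so a random
  array has the same law as a fixed array \<open>A\<close> relabelled by \<open>k + 1\<close> independent uniform permutations
  \<open>\<pi>\<^sub>j\<close>; all estimates are made for fixed \<open>A\<close> over the choice of \<open>\<pi>\<close>.

  Upper bound: a sequence of \<open>m\<close> points of the support of \<open>A\<close> becomes monotone with probability at
  most \<open>(2 / m!)^(k+1)\<close>, and there are \<open>n^(k m)\<close> such sequences; this union bound is at most
  \<open>2^(k+1) / n\<close> once \<open>m \<ge> 6 n^(k/(k+1))\<close>.

  Lower bound for \<open>k \<ge> 2\<close>: put about \<open>n^(k/(k+1))\<close> boxes of side \<open>s = \<lfloor>n^(1/(k+1))\<rfloor>\<close> along the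
  diagonal. Choosing one point in each nonempty box gives a monotone subsequence. A box is nonempty
  with probability bounded below, by the second moment method, and for two boxes these events are
  independent up to a factor \<open>exp (O(s\<^sup>2 / n))\<close>, which tends to 1 because \<open>s\<^sup>3 \<le> n\<close>; so Chebyshev's
  inequality applies to the number of nonempty boxes. For \<open>k = 1\<close> this factor does not tend to 1, but
  then the Erdos--Szekeres theorem gives a monotone subsequence of length at least \<open>\<surd>n\<close>.
\<close>

subsection \<open>Counting permutations\<close>

lemma real_card_eq_sum_of_bool: "finite X \<Longrightarrow> real (card {x \<in> X. S x}) = (\<Sum>x\<in>X. of_bool (S x))"
  by (simp add: of_bool_def sum.If_cases Int_def)

text \<open>Fix one permutation \<open>q\<close> of \<open>N\<close> that sends every
  \<open>g x\<close> to \<open>h x\<close>. The others are exactly the \<open>q \<circ> t\<close>,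
  where \<open>t\<close> permutes the points of \<open>N\<close> outside the image of
  \<open>g\<close>.\<close>

lemma card_permutes_extending:
  assumes N: "finite N" and g: "inj_on g I" "g ` I \<subseteq> N" and h: "inj_on h I" "h ` I \<subseteq> N"
  shows "card {p. p permutes N \<and> (\<forall>x\<in>I. p (g x) = h x)} = fact (card N - card I)"
proof -
  have fI: "finite (g ` I)" "finite (h ` I)"
    using N g(2) h(2) finite_subset by blast+
  have cI: "card (g ` I) = card I" "card (h ` I) = card I"
    using g(1) h(1) by (simp_all add: card_image)
  have "card (N - g ` I) = card (N - h ` I)"
    using fI cI g(2) h(2) by (simp add: card_Diff_subset)
  then obtain w where w: "bij_betw w (N - g ` I) (N - h ` I)"
    using N finite_same_card_bij[of "N - g ` I" "N - h ` I"] by auto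
  define v where "v = h \<circ> the_inv_into I g"
  have v: "bij_betw v (g ` I) (h ` I)"
    unfolding v_def using g(1) h(1)
    by (intro bij_betw_trans[of _ _ I] bij_betw_the_inv_into) (auto simp: bij_betw_def)
  have vg: "v (g x) = h x" if "x \<in> I" for x
    using that g(1) by (simp add: v_def the_inv_into_f_f)
  \<comment> \<open>\<open>q\<close> glues the prescribed part \<open>v\<close> to an arbitrary
    bijection \<open>w\<close> of the two complements, which have equal size. It is the identity off
    \<open>N\<close>, as \<open>permutes\<close> demands.\<close>
  define q where "q x = (if x \<in> g ` I then v x else if x \<in> N then w x else x)" for x
  have "bij_betw q (g ` I) (h ` I)"
    using v by (subst bij_betw_cong[of _ _ v]) (auto simp: q_def)
  moreover have "bij_betw q (N - g ` I) (N - h ` I)"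
    using w by (subst bij_betw_cong[of _ _ w]) (auto simp: q_def)
  ultimately have "bij_betw q (g ` I \<union> (N - g ` I)) (h ` I \<union> (N - h ` I))"
    by (rule bij_betw_combine) auto
  then have "bij_betw q N N"
    using g(2) h(2) by (simp add: Un_absorb1)
  then have q: "q permutes N"
    by (rule bij_imp_permutes) (use g(2) in \<open>auto simp: q_def\<close>)
  have qg: "q (g x) = h x" if "x \<in> I" for x
    using that by (simp add: q_def vg)
  have "{p. p permutes N \<and> (\<forall>x\<in>I. p (g x) = h x)} = (\<lambda>t. q \<circ> t) ` {t. t permutes (N - g ` I)}"
  proof (intro equalityI subsetI)
    fix p assume "p \<in> {p. p permutes N \<and> (\<forall>x\<in>I. p (g x) = h x)}"
    then have p: "p permutes N" "\<And>x. x \<in> I \<Longrightarrow> p (g x) = h x" by auto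
    define t where "t = inv q \<circ> p"
    have t: "t permutes N"
      unfolding t_def using p(1) q by (intro permutes_compose permutes_inv)
    have "t y = y" if y: "y \<in> N - (N - g ` I)" for y
    proof -
      obtain x where x: "x \<in> I" "y = g x" using y by blast
      have "p y = q y" using x p(2) qg by simp
      then show ?thesis using permutes_inverses(2)[OF q] by (simp add: t_def)
    qed
    then have "t permutes (N - g ` I)"
      using t permutes_superset[of t N "N - g ` I"] by auto
    moreover have "p = q \<circ> t"
      unfolding t_def using permutes_inverses(1)[OF q] by (auto simp: fun_eq_iff)
    ultimately show "p \<in> (\<lambda>t. q \<circ> t) ` {t. t permutes (N - g ` I)}" by blast
  next
    fix p assume "p \<in> (\<lambda>t. q \<circ> t) ` {t. t permutes (N - g ` I)}"
    then obtain t where t: "t permutes (N - g ` I)" "p = q \<circ> t" by auto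
    have "t permutes N" using t(1) permutes_subset by blast
    then have "p permutes N" using q t(2) by (simp add: permutes_compose)
    moreover have "p (g x) = h x" if "x \<in> I" for x
      using that t qg permutes_not_in[OF t(1), of "g x"] by simp
    ultimately show "p \<in> {p. p permutes N \<and> (\<forall>x\<in>I. p (g x) = h x)}" by auto
  qed
  moreover have "inj_on (\<lambda>t. q \<circ> t) {t. t permutes (N - g ` I)}"
    using permutes_inj[OF q] by (metis (no_types, lifting) inj_onI fun.inj_map injD)
  ultimately have "card {p. p permutes N \<and> (\<forall>x\<in>I. p (g x) = h x)} = fact (card (N - g ` I))"
    using N card_permutations[OF refl, of "N - g ` I"] by (simp add: card_image)
  also have "card (N - g ` I) = card N - card I"
    using fI cI g(2) by (simp add: card_Diff_subset)
  finally show ?thesis .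
qed

text \<open>Each \<open>p\<close> that sorts \<open>xs\<close> yields
  \<open>fact (length xs)\<close> permutations \<open>p \<circ> t\<close>, with \<open>t\<close>
  permuting the entries of \<open>xs\<close>, and all of these are distinct for different pairs. As
  an inequality the bound also covers lists with repeated entries, which no \<open>p\<close> makes
  strictly increasing.\<close>

lemma card_permutes_sorted_le:
  fixes N :: "nat set"
  assumes N: "finite N" and xs: "set xs \<subseteq> N"
  shows "card {p. p permutes N \<and> sorted_wrt (<) (map p xs)} * fact (length xs) \<le> fact (card N)"
proof -
  define X where "X = {p. p permutes N \<and> sorted_wrt (<) (map p xs)}"
  have X: "p permutes N" "sorted (map p xs)" "distinct (map p xs)" if "p \<in> X" for p
    using that strict_sorted_iff[of "map p xs"] unfolding X_def by blast+
  show ?thesis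
  proof (cases "X = {}")
    case True
    then show ?thesis unfolding X_def by (simp only: card.empty mult_0 le0)
  next
    case False
    \<comment> \<open>A list with a repeated entry has no strictly increasing image, so here the
      entries are distinct.\<close>
    then have dist: "distinct xs" using X(3) by (auto simp: distinct_map)
    define T where "T = {t. t permutes set xs}"
    have cT: "card T = fact (length xs)"
      using dist card_permutations[OF refl, of "set xs"] by (simp add: T_def distinct_card)
    have img: "(p \<circ> t) ` set xs = set (map p xs)" if "t \<in> T" for p :: "nat \<Rightarrow> nat" and t
      using that by (simp only: T_def mem_Collect_eq image_comp[symmetric] permutes_image set_map)
    have "inj_on (\<lambda>(p, t). p \<circ> t) (X \<times> T)"
    proof (rule inj_onI, clarify)
      fix p t p' t'
      assume p: "p \<in> X" and t: "t \<in> T" and p': "p' \<in> X" and t': "t' \<in> T"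
        and eq: "p \<circ> t = p' \<circ> t'"
      \<comment> \<open>\<open>t\<close> and \<open>t'\<close> only shuffle the entries of
        \<open>xs\<close>, so \<open>p\<close> and \<open>p'\<close> take the same set of values
        there. A strictly increasing list is determined by its set of values, so \<open>p\<close>
        and \<open>p'\<close> agree on \<open>xs\<close>.\<close>
      have "set (map p xs) = set (map p' xs)"
        using img[OF t, of p] img[OF t', of p'] eq by metis
      then have "map p xs = map p' xs"
        using sorted_distinct_set_unique X[OF p] X[OF p'] by blast
      then have on: "p x = p' x" if "x \<in> set xs" for x using that by simp
      have "p x = p' x" if "x \<notin> set xs" for x
        using fun_cong[OF eq, of x] t t' that by (simp add: T_def permutes_not_in)
      with on have "p = p'" by blast
      moreover have "t = t'"
        using eq permutes_inj[OF X(1)[OF p]] unfolding \<open>p = p'\<close>[symmetric]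
        by (auto simp: fun_eq_iff inj_eq)
      ultimately show "p = p' \<and> t = t'" by simp
    qed
    moreover have "(\<lambda>(p, t). p \<circ> t) ` (X \<times> T) \<subseteq> {p. p permutes N}"
      using xs X(1) permutes_subset[of _ "set xs" N] by (auto simp: T_def intro: permutes_compose)
    ultimately have "card (X \<times> T) \<le> card {p. p permutes N}"
      using N finite_permutations[OF N] by (intro card_inj_on_le)
    then show ?thesis
      using N by (simp add: card_cartesian_product cT card_permutations X_def)
  qed
qed

text \<open>Decreasing along \<open>xs\<close> is increasing along \<open>rev xs\<close>; the two
  directions account for the factor 2.\<close>

lemma card_permutes_monotone_le:
  fixes N :: "nat set"
  assumes N: "finite N" and xs: "set xs \<subseteq> N"
  shows "real (card {p. p permutes N \<and> (sorted_wrt (<) (map p xs) \<or> sorted_wrt (>) (map p xs))})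
    \<le> 2 / fact (length xs) * fact (card N)"
proof -
  have bd: "real (card {p. p permutes N \<and> sorted_wrt (<) (map p ys)}) \<le> fact (card N) / fact (length xs)"
    if "set ys \<subseteq> N" "length ys = length xs" for ys
  proof -
    have "real (card {p. p permutes N \<and> sorted_wrt (<) (map p ys)}) * real (fact (length ys))
      \<le> real (fact (card N))"
      using card_permutes_sorted_le[OF N that(1)] unfolding of_nat_mult[symmetric] of_nat_le_iff .
    then show ?thesis using that by (simp add: field_simps)
  qed
  have "{p. p permutes N \<and> (sorted_wrt (<) (map p xs) \<or> sorted_wrt (>) (map p xs))}
    = {p. p permutes N \<and> sorted_wrt (<) (map p xs)} \<union> {p. p permutes N \<and> sorted_wrt (<) (map p (rev xs))}"
    by (auto simp: rev_map[symmetric] sorted_wrt_rev)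
  then have "real (card {p. p permutes N \<and> (sorted_wrt (<) (map p xs) \<or> sorted_wrt (>) (map p xs))})
    \<le> real (card {p. p permutes N \<and> sorted_wrt (<) (map p xs)})
      + real (card {p. p permutes N \<and> sorted_wrt (<) (map p (rev xs))})"
    unfolding of_nat_add[symmetric] of_nat_le_iff by (simp only: card_Un_le)
  then show ?thesis using bd[of xs] bd[of "rev xs"] xs by simp
qed

lemma card_permutes_hit:
  assumes N: "finite N" and x: "x \<in> N" and I: "I \<subseteq> N"
  shows "real (card {p. p permutes N \<and> p x \<in> I}) = card I / card N * fact (card N)"
proof -
  have fI: "finite I" using I N finite_subset by blast
  \<comment> \<open>The vacuous quantifier over \<open>{u}\<close> brings each piece into the shape
    of \<open>card_permutes_extending\<close>, with constant maps on a one-point index set.\<close>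
  have "{p. p permutes N \<and> p x \<in> I} = (\<Union>u\<in>I. {p. p permutes N \<and> (\<forall>z\<in>{u}. p x = u)})"
    by auto
  also have "card \<dots> = (\<Sum>u\<in>I. card {p. p permutes N \<and> (\<forall>z\<in>{u}. p x = u)})"
    by (intro card_UN_disjoint fI) (auto intro: finite_subset[OF _ finite_permutations[OF N]])
  also have "\<dots> = (\<Sum>u\<in>I. fact (card N - 1))"
  proof (rule sum.cong[OF refl])
    fix u assume "u \<in> I"
    then show "card {p. p permutes N \<and> (\<forall>z\<in>{u}. p x = u)} = fact (card N - 1)"
      using card_permutes_extending[OF N, of "\<lambda>_. x" "{u}" "\<lambda>_. u"] x I by auto
  qed
  finally have "card {p. p permutes N \<and> p x \<in> I} = card I * fact (card N - 1)" by simp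
  moreover have "card N > 0" using x N card_gt_0_iff by blast
  ultimately show ?thesis by (simp add: fact_reduce[of "card N"])
qed

text \<open>The cases \<open>x = y\<close> and \<open>x \<noteq> y\<close> are merged into one sum
  so that the product of these bounds over all coordinates can later be multiplied out over the sets
  of agreeing coordinates.\<close>

lemma card_permutes_hit2_le:
  assumes N: "finite N" "card N \<ge> 2" and xy: "x \<in> N" "y \<in> N" and I: "I \<subseteq> N"
  shows "real (card {p. p permutes N \<and> p x \<in> I \<and> p y \<in> I})
    \<le> card I / card N * ((if x = y then 1 else 0) + 2 * card I / card N) * fact (card N)"
proof (cases "x = y")
  case True
  then have "real (card {p. p permutes N \<and> p x \<in> I \<and> p y \<in> I}) = card I / card N * 1 * fact (card N)"
    using card_permutes_hit[OF N(1) xy(1) I] by simp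
  also have "\<dots> \<le> card I / card N * ((if x = y then 1 else 0) + 2 * card I / card N) * fact (card N)"
    using True by (intro mult_right_mono mult_left_mono) auto
  finally show ?thesis .
next
  case False
  have fI: "finite I" using I N finite_subset by blast
  define S where "S = (\<lambda>(u, v). {p. p permutes N \<and> (\<forall>z\<in>{x, y}. p z = (if z = x then u else v))})"
  have "{p. p permutes N \<and> p x \<in> I \<and> p y \<in> I} \<subseteq> (\<Union>w\<in>I \<times> I. S w)"
    using False by (auto simp: S_def)
  moreover have fS: "finite (\<Union>w\<in>I \<times> I. S w)"
    using fI by (auto simp: S_def intro!: finite_subset[OF _ finite_permutations[OF N(1)]])
  ultimately have "card {p. p permutes N \<and> p x \<in> I \<and> p y \<in> I} \<le> card (\<Union>w\<in>I \<times> I. S w)"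
    by (intro card_mono)
  also have "\<dots> \<le> (\<Sum>w\<in>I \<times> I. card (S w))"
    using fI by (intro card_UN_le) auto
  also have "\<dots> \<le> (\<Sum>w\<in>I \<times> I. fact (card N - 2))"
  proof (rule sum_mono)
    fix w assume "w \<in> I \<times> I"
    then obtain u v where w: "w = (u, v)" "u \<in> I" "v \<in> I" by auto
    show "card (S w) \<le> fact (card N - 2)"
    proof (cases "u = v")
      case True
      have "S w = {}"
        using False True w by (auto simp: S_def dest: permutes_inj injD)
      then show ?thesis by simp
    next
      case ne: False
      have "card (S w) = fact (card N - card {x, y})"
        unfolding S_def w prod.case using ne False xy I w N
        by (intro card_permutes_extending) (auto simp: inj_on_def)
      moreover have "card {x, y} = 2" using False by simp
      ultimately show ?thesis by (simp only:)
    qed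
  qed
  also have "\<dots> = card I * card I * fact (card N - 2)"
    by (simp add: card_cartesian_product)
  finally have "real (card {p. p permutes N \<and> p x \<in> I \<and> p y \<in> I})
      \<le> real (card I * card I * fact (card N - 2))"
    by (rule of_nat_mono)
  also have "\<dots> = real (card I) * real (card I) * fact (card N - 2) * 1" by simp
  \<comment> \<open>The inserted factor is at least 1 because \<open>card N \<ge> 2\<close>. It
    replaces the exact denominator N (N - 1) by N^2 at the cost of a factor 2.\<close>
  also have "\<dots> \<le> real (card I) * real (card I) * fact (card N - 2) * (2 * real (card N - 1) / card N)"
    using N(2) by (intro mult_left_mono) (simp_all add: field_simps of_nat_diff)
  also have "\<dots> = real (card I) / card N * (2 * real (card I) / card N)
      * (real (card N) * (real (card N - 1) * fact (card N - 2)))"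
  proof -
    have "a * a * f * (2 * r / m) = a / m * (2 * a / m) * (m * (r * f))"
      if "m \<noteq> 0" for a f r m :: real
      using that by (simp add: field_simps)
    moreover have "real (card N) \<noteq> 0" using N(2) by simp
    ultimately show ?thesis by blast
  qed
  also have "real (card N) * (real (card N - 1) * fact (card N - 2)) = fact (card N)"
  proof -
    obtain m where "card N = Suc (Suc m)" using N(2) by (metis add_2_eq_Suc le_Suc_ex)
    then show ?thesis by simp
  qed
  finally show ?thesis using False by simp
qed

subsection \<open>Relabelling coordinates\<close>

text \<open>The tuples are extensional, so that each choice of \<open>k + 1\<close> permutations is
  counted once.\<close>

definition relabellings :: "nat \<Rightarrow> nat \<Rightarrow> (nat \<Rightarrow> nat \<Rightarrow> nat) set" where
  "relabellings k n = {1..k+1} \<rightarrow>\<^sub>E {p. p permutes {1..n}}"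

definition relabel :: "nat \<Rightarrow> (nat \<Rightarrow> nat \<Rightarrow> nat) \<Rightarrow> (nat \<Rightarrow> nat) \<Rightarrow> nat \<Rightarrow> nat" where
  "relabel k \<pi> \<alpha> = (\<lambda>j\<in>{1..k+1}. \<pi> j (\<alpha> j))"

text \<open>Pulling \<open>A\<close> back along the inverses moves its support forward along
  \<open>\<pi>\<close>; see \<open>support_relabel_array\<close>.\<close>

definition relabel_array ::
    "nat \<Rightarrow> nat \<Rightarrow> (nat \<Rightarrow> nat \<Rightarrow> nat) \<Rightarrow> ((nat \<Rightarrow> nat) \<Rightarrow> nat) \<Rightarrow> (nat \<Rightarrow> nat) \<Rightarrow> nat" where
  "relabel_array k n \<pi> A = (\<lambda>\<alpha>\<in>positions k n. A (relabel k (\<lambda>j. inv (\<pi> j)) \<alpha>))"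

lemma relabellings_permutes: "\<pi> \<in> relabellings k n \<Longrightarrow> j \<in> {1..k+1} \<Longrightarrow> \<pi> j permutes {1..n}"
  using PiE_mem[of \<pi> "{1..k+1}" "\<lambda>_. {p. p permutes {1..n}}" j] unfolding relabellings_def by blast

lemma relabel_apply: "j \<in> {1..k+1} \<Longrightarrow> relabel k \<pi> \<alpha> j = \<pi> j (\<alpha> j)"
  unfolding relabel_def by (rule restrict_apply')

lemma finite_relabellings: "finite (relabellings k n)"
  unfolding relabellings_def by (intro finite_PiE) (auto intro: finite_permutations)

text \<open>This is the independence of the \<open>k + 1\<close> random permutations, in counting
  form.\<close>

lemma card_relabellings_PiE:
  "card {\<pi> \<in> relabellings k n. \<forall>j\<in>{1..k+1}. R j (\<pi> j)}
    = (\<Prod>j\<in>{1..k+1}. card {p. p permutes {1..n} \<and> R j p})"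
proof -
  have "{\<pi> \<in> relabellings k n. \<forall>j\<in>{1..k+1}. R j (\<pi> j)}
      = PiE {1..k+1} (\<lambda>j. {p. p permutes {1..n} \<and> R j p})"
    unfolding relabellings_def set_eq_iff mem_Collect_eq PiE_iff by blast
  then show ?thesis by (simp only: card_PiE[OF finite_atLeastAtMost])
qed

lemma card_relabellings: "card (relabellings k n) = fact n ^ (k + 1)"
proof -
  have "card {p. p permutes {1..n}} = fact n"
    by (rule card_permutations) simp_all
  then show ?thesis using card_relabellings_PiE[of k n "\<lambda>_ _. True"] by simp
qed

lemma relabel_positions:
  assumes "\<And>j. j \<in> {1..k+1} \<Longrightarrow> \<tau> j permutes {1..n}" and "\<alpha> \<in> positions k n"
  shows "relabel k \<tau> \<alpha> \<in> positions k n"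
proof -
  have "\<tau> j (\<alpha> j) \<in> {1..n}" if "j \<in> {1..k+1}" for j
    using permutes_in_image[OF assms(1)[OF that]] PiE_mem[OF assms(2)[unfolded positions_def] that]
    by blast
  then show ?thesis
    unfolding positions_def relabel_def by (rule restrict_PiE_iff[THEN iffD2, rule_format])
qed

lemma relabel_relabel:
  assumes "\<And>j x. j \<in> {1..k+1} \<Longrightarrow> \<tau> j (\<sigma> j x) = x" and "\<alpha> \<in> positions k n"
  shows "relabel k \<tau> (relabel k \<sigma> \<alpha>) = \<alpha>"
proof
  fix j
  show "relabel k \<tau> (relabel k \<sigma> \<alpha>) j = \<alpha> j"
  proof (cases "j \<in> {1..k+1}")
    case True
    then show ?thesis by (simp only: relabel_apply assms(1))
  next
    case False
    then show ?thesis
      using PiE_arb[OF assms(2)[unfolded positions_def] False]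
      by (simp only: relabel_def restrict_def if_False)
  qed
qed

lemma relabel_inv:
  assumes "\<pi> \<in> relabellings k n" and "\<alpha> \<in> positions k n"
  shows "relabel k (\<lambda>j. inv (\<pi> j)) (relabel k \<pi> \<alpha>) = \<alpha>"
    and "relabel k \<pi> (relabel k (\<lambda>j. inv (\<pi> j)) \<alpha>) = \<alpha>"
  using permutes_inverses[OF relabellings_permutes[OF assms(1)]]
  by (rule_tac relabel_relabel[OF _ assms(2)]; blast)+

lemma relabel_in_positions:
  assumes "\<pi> \<in> relabellings k n" and "\<alpha> \<in> positions k n"
  shows "relabel k (\<lambda>j. inv (\<pi> j)) \<alpha> \<in> positions k n" and "relabel k \<pi> \<alpha> \<in> positions k n"
  by (rule relabel_positions[OF permutes_inv[OF relabellings_permutes[OF assms(1)]] assms(2)],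
      assumption, rule relabel_positions[OF relabellings_permutes[OF assms(1)] assms(2)])

lemma line_relabel:
  assumes \<pi>: "\<pi> \<in> relabellings k n" and \<alpha>: "\<alpha> \<in> positions k n" "\<alpha>0 \<in> positions k n"
    and on_line: "\<alpha> \<in> line k n j \<alpha>0"
  shows "relabel k (\<lambda>j. inv (\<pi> j)) \<alpha> \<in> line k n j (relabel k (\<lambda>j. inv (\<pi> j)) \<alpha>0)"
    and "relabel k \<pi> \<alpha> \<in> line k n j (relabel k \<pi> \<alpha>0)"
  using on_line relabel_in_positions[OF \<pi> \<alpha>(1)] by (simp_all add: line_def relabel_apply)

text \<open>Relabelling carries lines bijectively to lines in the same direction, so the unique 1 on
  each line is transported along.\<close>

lemma relabel_array_in_hd_permutations:
  assumes \<pi>: "\<pi> \<in> relabellings k n" and A: "A \<in> hd_permutations k n"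
  shows "relabel_array k n \<pi> A \<in> hd_permutations k n"
proof -
  let ?\<tau> = "relabel k (\<lambda>j. inv (\<pi> j))"
  have "\<exists>!\<alpha>. \<alpha> \<in> line k n j \<alpha>0 \<and> relabel_array k n \<pi> A \<alpha> = 1"
    if j: "j \<in> {1..k+1}" and \<alpha>0: "\<alpha>0 \<in> positions k n" for j \<alpha>0
  proof -
    have val: "relabel_array k n \<pi> A \<alpha> = A (?\<tau> \<alpha>)" if "\<alpha> \<in> line k n j \<alpha>0" for \<alpha>
      using that by (simp add: relabel_array_def line_def)
    have "line k n j (?\<tau> \<alpha>0) \<in> lines k n"
      unfolding lines_def using j relabel_in_positions(1)[OF \<pi> \<alpha>0] by blast
    then have "\<exists>!\<beta>. \<beta> \<in> line k n j (?\<tau> \<alpha>0) \<and> A \<beta> = 1"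
      using A unfolding hd_permutations_def by blast
    then obtain \<beta> where \<beta>: "\<beta> \<in> line k n j (?\<tau> \<alpha>0)" "A \<beta> = 1"
      and uniq: "\<And>\<gamma>. \<gamma> \<in> line k n j (?\<tau> \<alpha>0) \<Longrightarrow> A \<gamma> = 1 \<Longrightarrow> \<gamma> = \<beta>" by blast
    have \<beta>p: "\<beta> \<in> positions k n" using \<beta>(1) by (simp add: line_def)
    show ?thesis
    proof (rule ex1I[of _ "relabel k \<pi> \<beta>"])
      have "relabel k \<pi> \<beta> \<in> line k n j \<alpha>0"
        using line_relabel(2)[OF \<pi> \<beta>p relabel_in_positions(1)[OF \<pi> \<alpha>0] \<beta>(1)] relabel_inv(2)[OF \<pi> \<alpha>0]
        by simp
      then show "relabel k \<pi> \<beta> \<in> line k n j \<alpha>0 \<and> relabel_array k n \<pi> A (relabel k \<pi> \<beta>) = 1"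
        using val \<beta>(2) relabel_inv(1)[OF \<pi> \<beta>p] by simp
    next
      fix \<alpha> assume \<alpha>: "\<alpha> \<in> line k n j \<alpha>0 \<and> relabel_array k n \<pi> A \<alpha> = 1"
      then have \<alpha>p: "\<alpha> \<in> positions k n" by (simp add: line_def)
      have "?\<tau> \<alpha> = \<beta>"
        using \<alpha> val line_relabel(1)[OF \<pi> \<alpha>p \<alpha>0] by (intro uniq) auto
      then show "\<alpha> = relabel k \<pi> \<beta>" using relabel_inv(2)[OF \<pi> \<alpha>p] by simp
    qed
  qed
  moreover have "relabel_array k n \<pi> A \<in> positions k n \<rightarrow>\<^sub>E {0, 1}"
  proof -
    have "A \<in> positions k n \<rightarrow>\<^sub>E {0, 1}" using A unfolding hd_permutations_def by blast
    then have "A (?\<tau> \<alpha>) \<in> {0, 1}" if "\<alpha> \<in> positions k n" for \<alpha>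
      using relabel_in_positions(1)[OF \<pi> that] by (rule PiE_mem)
    then show ?thesis
      unfolding relabel_array_def by (rule restrict_PiE_iff[THEN iffD2, rule_format])
  qed
  ultimately show ?thesis
    unfolding hd_permutations_def lines_def by blast
qed

lemma bij_betw_relabel_array:
  assumes \<pi>: "\<pi> \<in> relabellings k n"
  shows "bij_betw (relabel_array k n \<pi>) (hd_permutations k n) (hd_permutations k n)"
proof -
  have "inj_on (relabel_array k n \<pi>) (hd_permutations k n)"
  proof (rule inj_onI)
    fix A B assume A: "A \<in> hd_permutations k n" and B: "B \<in> hd_permutations k n"
      and eq: "relabel_array k n \<pi> A = relabel_array k n \<pi> B"
    have "A \<alpha> = B \<alpha>" if \<alpha>: "\<alpha> \<in> positions k n" for \<alpha>
      using fun_cong[OF eq, of "relabel k \<pi> \<alpha>"] relabel_in_positions(2)[OF \<pi> \<alpha>] relabel_inv(1)[OF \<pi> \<alpha>]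
      by (simp add: relabel_array_def)
    moreover have "A \<in> positions k n \<rightarrow>\<^sub>E {0, 1}" "B \<in> positions k n \<rightarrow>\<^sub>E {0, 1}"
      using A B by (simp_all only: hd_permutations_def mem_Collect_eq)
    ultimately show "A = B" by (blast intro: PiE_ext)
  qed
  moreover have "relabel_array k n \<pi> ` hd_permutations k n \<subseteq> hd_permutations k n"
    using relabel_array_in_hd_permutations[OF \<pi>] by blast
  ultimately show ?thesis
    by (simp add: bij_betw_def endo_inj_surj[OF finite_hd_permutations])
qed

lemma support_relabel_array:
  assumes \<pi>: "\<pi> \<in> relabellings k n"
  shows "support k n (relabel_array k n \<pi> A) = relabel k \<pi> ` support k n A"
proof (intro equalityI subsetI)
  fix \<alpha> assume "\<alpha> \<in> support k n (relabel_array k n \<pi> A)"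
  then have \<alpha>: "\<alpha> \<in> positions k n" "A (relabel k (\<lambda>j. inv (\<pi> j)) \<alpha>) = 1"
    by (auto simp: support_def relabel_array_def)
  then have "relabel k (\<lambda>j. inv (\<pi> j)) \<alpha> \<in> support k n A"
    using relabel_in_positions(1)[OF \<pi>] by (simp add: support_def)
  then show "\<alpha> \<in> relabel k \<pi> ` support k n A"
    using relabel_inv(2)[OF \<pi> \<alpha>(1)] by (metis image_eqI)
next
  fix \<alpha> assume "\<alpha> \<in> relabel k \<pi> ` support k n A"
  then obtain \<beta> where \<beta>: "\<beta> \<in> positions k n" "A \<beta> = 1" "\<alpha> = relabel k \<pi> \<beta>"
    by (auto simp: support_def)
  then show "\<alpha> \<in> support k n (relabel_array k n \<pi> A)"
    using relabel_in_positions(2)[OF \<pi>] relabel_inv(1)[OF \<pi>] by (simp add: support_def relabel_array_def)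
qed

text \<open>Double counting of pairs of an array and a relabelling. For each fixed
  \<open>\<pi>\<close>, relabelling permutes the arrays, so averaging over \<open>A\<close> alone
  equals averaging over \<open>A\<close> and \<open>\<pi>\<close>; a bound over \<open>\<pi>\<close>
  that holds for every fixed \<open>A\<close> then passes to the random array.\<close>

lemma prob_random_hd_permutation_le:
  fixes \<epsilon> :: real
  assumes bound: "\<And>A. A \<in> hd_permutations k n \<Longrightarrow>
      real (card {\<pi> \<in> relabellings k n. R (relabel_array k n \<pi> A)}) \<le> \<epsilon> * card (relabellings k n)"
  shows "measure_pmf.prob (random_hd_permutation k n) {A. R A} \<le> \<epsilon>"
proof -
  let ?L = "hd_permutations k n" and ?P = "relabellings k n"
  have cP: "real (card ?P) > 0" using card_relabellings by simp
  have cL: "real (card ?L) > 0"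
    using finite_hd_permutations hd_permutations_nonempty card_gt_0_iff by fastforce
  have "real (card ?P) * real (card {A \<in> ?L. R A}) = (\<Sum>\<pi>\<in>?P. \<Sum>A\<in>?L. of_bool (R A))"
    by (simp add: real_card_eq_sum_of_bool[OF finite_hd_permutations])
  also have "\<dots> = (\<Sum>\<pi>\<in>?P. \<Sum>A\<in>?L. of_bool (R (relabel_array k n \<pi> A)))"
    by (intro sum.cong refl sum.reindex_bij_betw[symmetric] bij_betw_relabel_array)
  also have "\<dots> = (\<Sum>A\<in>?L. \<Sum>\<pi>\<in>?P. of_bool (R (relabel_array k n \<pi> A)))"
    by (rule sum.swap)
  also have "\<dots> \<le> (\<Sum>A\<in>?L. \<epsilon> * card ?P)"
    using bound by (intro sum_mono) (simp add: real_card_eq_sum_of_bool[OF finite_relabellings, symmetric])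
  finally have "real (card {A \<in> ?L. R A}) \<le> \<epsilon> * real (card ?L)"
    using cP by (simp add: field_simps)
  moreover have "measure_pmf.prob (random_hd_permutation k n) {A. R A} = card {A \<in> ?L. R A} / card ?L"
    unfolding random_hd_permutation_def
    using measure_pmf_of_set[OF hd_permutations_nonempty finite_hd_permutations] by (simp add: Int_def)
  ultimately show ?thesis using cL by (simp only: divide_le_eq if_True)
qed

section \<open>Sizes of supports and of their slices\<close>

lemma support_unique:
  assumes A: "A \<in> hd_permutations k n" and j: "j \<in> {1..k+1}"
    and \<alpha>: "\<alpha> \<in> support k n A" and \<beta>: "\<beta> \<in> support k n A"
    and eq: "\<And>i. i \<in> {1..k+1} - {j} \<Longrightarrow> \<alpha> i = \<beta> i"
  shows "\<alpha> = \<beta>"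
proof -
  have p: "\<alpha> \<in> positions k n" "\<beta> \<in> positions k n" "A \<alpha> = 1" "A \<beta> = 1"
    using \<alpha> \<beta> by (auto simp: support_def)
  have "line k n j \<beta> \<in> lines k n" using j p by (auto simp: lines_def)
  then have "\<exists>!\<gamma>. \<gamma> \<in> line k n j \<beta> \<and> A \<gamma> = 1"
    using A by (auto simp: hd_permutations_def)
  moreover have "\<alpha> \<in> line k n j \<beta>" "\<beta> \<in> line k n j \<beta>" using p eq by (auto simp: line_def)
  ultimately show ?thesis using p by blast
qed

lemma support_exists:
  assumes A: "A \<in> hd_permutations k n" and j: "j \<in> {1..k+1}" and \<alpha>: "\<alpha> \<in> positions k n"
  obtains \<beta> where "\<beta> \<in> support k n A" "\<And>i. i \<in> {1..k+1} - {j} \<Longrightarrow> \<beta> i = \<alpha> i"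
proof -
  have "line k n j \<alpha> \<in> lines k n" using j \<alpha> by (auto simp: lines_def)
  then obtain \<gamma> where "\<gamma> \<in> line k n j \<alpha>" "A \<gamma> = 1"
    using A by (auto simp: hd_permutations_def)
  then show thesis using that[of \<gamma>] by (auto simp: line_def support_def)
qed

lemma finite_support: "finite (support k n A)"
  unfolding support_def using finite_positions by simp

text \<open>Since \<open>E\<close> is proper, some coordinate \<open>j\<close> lies outside it. A
  point of the support is determined by its coordinates other than \<open>j\<close>; those in
  \<open>E\<close> are fixed, which leaves \<open>k - card E\<close> free ones.\<close>

lemma card_support_agree_le:
  assumes A: "A \<in> hd_permutations k n" and E: "E \<subset> {1..k+1}"
  shows "card {\<gamma> \<in> support k n A. \<forall>i\<in>E. \<gamma> i = \<beta> i} \<le> n ^ (k - card E)"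
proof -
  obtain j where j: "j \<in> {1..k+1}" "j \<notin> E" using E by blast
  define F where "F = {1..k+1} - E - {j}"
  have "inj_on (\<lambda>\<gamma>. restrict \<gamma> F) {\<gamma> \<in> support k n A. \<forall>i\<in>E. \<gamma> i = \<beta> i}"
  proof (rule inj_onI)
    fix \<gamma> \<delta>
    assume \<gamma>: "\<gamma> \<in> {\<gamma> \<in> support k n A. \<forall>i\<in>E. \<gamma> i = \<beta> i}"
      and \<delta>: "\<delta> \<in> {\<gamma> \<in> support k n A. \<forall>i\<in>E. \<gamma> i = \<beta> i}"
      and eq: "restrict \<gamma> F = restrict \<delta> F"
    have "\<gamma> i = \<delta> i" if "i \<in> {1..k+1} - {j}" for i
    proof (cases "i \<in> E")
      case False
      then have "i \<in> F" using that by (auto simp: F_def)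
      then show ?thesis using fun_cong[OF eq, of i] by simp
    qed (use \<gamma> \<delta> in auto)
    then show "\<gamma> = \<delta>" using support_unique[OF A j(1)] \<gamma> \<delta> by blast
  qed
  moreover have "(\<lambda>\<gamma>. restrict \<gamma> F) ` {\<gamma> \<in> support k n A. \<forall>i\<in>E. \<gamma> i = \<beta> i} \<subseteq> F \<rightarrow>\<^sub>E {1..n}"
  proof (rule image_subsetI)
    fix \<gamma> assume "\<gamma> \<in> {\<gamma> \<in> support k n A. \<forall>i\<in>E. \<gamma> i = \<beta> i}"
    then have "\<gamma> \<in> {1..k+1} \<rightarrow>\<^sub>E {1..n}" by (simp only: support_def positions_def mem_Collect_eq)
    then have "\<gamma> i \<in> {1..n}" if "i \<in> F" for i
      using that unfolding F_def by blast
    then show "restrict \<gamma> F \<in> F \<rightarrow>\<^sub>E {1..n}"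
      by (rule restrict_PiE_iff[THEN iffD2, rule_format])
  qed
  ultimately have "card {\<gamma> \<in> support k n A. \<forall>i\<in>E. \<gamma> i = \<beta> i} \<le> card (F \<rightarrow>\<^sub>E {1..n})"
    by (intro card_inj_on_le finite_PiE) (auto simp: F_def)
  also have "card F = k - card E"
  proof -
    have "finite E" using finite_subset[OF psubset_imp_subset[OF E]] by simp
    then have "card ({1..k+1} - E) = k + 1 - card E"
      using E by (subst card_Diff_subset) auto
    then show ?thesis using j by (simp add: F_def)
  qed
  then have "card (F \<rightarrow>\<^sub>E {1..n}) = n ^ (k - card E)"
    by (subst card_PiE) (auto simp: F_def)
  finally show ?thesis .
qed

lemma card_support:
  assumes A: "A \<in> hd_permutations k n" and n: "n \<ge> 1"
  shows "card (support k n A) = n ^ k"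
proof (rule antisym)
  show "card (support k n A) \<le> n ^ k"
  proof -
    have "{} \<subset> {1..k+1}" by auto
    from card_support_agree_le[OF A this] show ?thesis by simp
  qed
  define F where "F = {1..k+1} - {1::nat}"
  have "F \<rightarrow>\<^sub>E {1..n} \<subseteq> (\<lambda>\<gamma>. restrict \<gamma> F) ` support k n A"
  proof
    fix f assume f: "f \<in> F \<rightarrow>\<^sub>E {1..n}"
    \<comment> \<open>The value 1 is a placeholder: only the line in direction 1 through this
      position matters, and the support meets it.\<close>
    have "f(1 := 1) \<in> positions k n"
      using f n unfolding positions_def F_def by (auto simp: PiE_iff extensional_def)
    then obtain \<beta> where \<beta>: "\<beta> \<in> support k n A" "\<And>i. i \<in> {1..k+1} - {1} \<Longrightarrow> \<beta> i = (f(1 := 1)) i"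
      by (rule support_exists[OF A, of 1, rotated]) auto
    have "f = restrict \<beta> F"
    proof
      fix i show "f i = restrict \<beta> F i"
        using \<beta>(2)[of i] PiE_arb[OF f, of i] by (cases "i \<in> F") (auto simp: F_def)
    qed
    then show "f \<in> (\<lambda>\<gamma>. restrict \<gamma> F) ` support k n A" using \<beta>(1) by blast
  qed
  then have "card (F \<rightarrow>\<^sub>E {1..n}) \<le> card (support k n A)"
    by (rule surj_card_le[OF finite_support])
  moreover have "card (F \<rightarrow>\<^sub>E {1..n}) = n ^ k"
    by (subst card_PiE) (auto simp: F_def)
  ultimately show "n ^ k \<le> card (support k n A)" by simp
qed

subsection \<open>Upper bound\<close>

text \<open>Prefixes of monotone subsequences are monotone, so every smaller length is attained
  exactly. The union bound can therefore run over lists of one fixed length.\<close>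

lemma longest_monotone_ge_iff:
  "m \<le> longest_monotone k n A \<longleftrightarrow> (\<exists>s. monotone_subsequence k n A s \<and> length s = m)"
proof
  let ?S = "{length s | s. monotone_subsequence k n A s}"
  assume "m \<le> longest_monotone k n A"
  moreover have "?S \<noteq> {}" using monotone_subsequence_Nil by blast
  then have "Max ?S \<in> ?S" by (intro Max_in finite_monotone_lengths)
  ultimately obtain s where s: "monotone_subsequence k n A s" "m \<le> length s"
    unfolding longest_monotone_def by auto
  have "monotone_subsequence k n A (take m s)"
    using s(1) set_take_subset[of m s]
    by (auto simp: monotone_subsequence_def take_map[symmetric] sorted_wrt_take)
  then show "\<exists>s. monotone_subsequence k n A s \<and> length s = m" using s(2) by fastforce
next
  assume "\<exists>s. monotone_subsequence k n A s \<and> length s = m"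
  then show "m \<le> longest_monotone k n A"
    unfolding longest_monotone_def by (auto intro: Max_ge finite_monotone_lengths)
qed

lemma card_relabellings_longest_monotone_le:
  assumes A: "A \<in> hd_permutations k n" and n: "n \<ge> 1"
  shows "real (card {\<pi> \<in> relabellings k n. m \<le> longest_monotone k n (relabel_array k n \<pi> A)})
    \<le> real n ^ (k * m) * (2 / fact m) ^ (k + 1) * card (relabellings k n)"
proof -
  let ?mon = "\<lambda>xs. sorted_wrt (<) xs \<or> sorted_wrt (>) (xs :: nat list)"
  define G where "G = support k n A"
  define T where "T = {xs. set xs \<subseteq> G \<and> length xs = m}"
  define U where "U xs = {\<pi> \<in> relabellings k n. \<forall>j\<in>{1..k+1}. ?mon (map (\<pi> j) (map (\<lambda>\<alpha>. \<alpha> j) xs))}"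
    for xs :: "(nat \<Rightarrow> nat) list"
  have finT: "finite T" unfolding T_def G_def by (intro finite_lists_length_eq finite_support)
  have cT: "card T = n ^ (k * m)"
    unfolding T_def using card_lists_length_eq[OF finite_support[of k n A]] card_support[OF A n]
    by (simp add: G_def power_mult)
  have finU: "finite (U xs)" for xs
    unfolding U_def using finite_relabellings by simp
  have cU: "real (card (U xs)) \<le> (2 / fact m) ^ (k + 1) * card (relabellings k n)" if xs: "xs \<in> T" for xs
  proof -
    have "real (card (U xs))
        = (\<Prod>j\<in>{1..k+1}. real (card {p. p permutes {1..n} \<and> ?mon (map p (map (\<lambda>\<alpha>. \<alpha> j) xs))}))"
      unfolding U_def
      using card_relabellings_PiE[of k n "\<lambda>j p. ?mon (map p (map (\<lambda>\<alpha>. \<alpha> j) xs))"]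
      by (simp only: of_nat_prod)
    also have "\<dots> \<le> (\<Prod>j\<in>{1..k+1}. 2 / fact m * fact n)"
    proof (intro prod_mono conjI of_nat_0_le_iff)
      fix j assume j: "j \<in> {1..k+1}"
      have "\<alpha> j \<in> {1..n}" if "\<alpha> \<in> set xs" for \<alpha>
        using xs that j unfolding T_def G_def support_def positions_def by (blast dest: PiE_mem)
      then have "set (map (\<lambda>\<alpha>. \<alpha> j) xs) \<subseteq> {1..n}" by auto
      from card_permutes_monotone_le[OF finite_atLeastAtMost this]
      show "real (card {p. p permutes {1..n} \<and> ?mon (map p (map (\<lambda>\<alpha>. \<alpha> j) xs))}) \<le> 2 / fact m * fact n"
        using xs by (simp add: T_def)
    qed
    also have "\<dots> = (2 / fact m) ^ (k + 1) * card (relabellings k n)"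
      by (simp add: card_relabellings power_mult_distrib power_divide)
    finally show ?thesis .
  qed
  have "{\<pi> \<in> relabellings k n. m \<le> longest_monotone k n (relabel_array k n \<pi> A)} \<subseteq> (\<Union>xs\<in>T. U xs)"
  proof
    fix \<pi> assume "\<pi> \<in> {\<pi> \<in> relabellings k n. m \<le> longest_monotone k n (relabel_array k n \<pi> A)}"
    then obtain s where \<pi>: "\<pi> \<in> relabellings k n"
      and s: "monotone_subsequence k n (relabel_array k n \<pi> A) s" "length s = m"
      by (auto simp: longest_monotone_ge_iff)
    have "set s \<subseteq> relabel k \<pi> ` G"
      using s(1) support_relabel_array[OF \<pi>] by (simp add: monotone_subsequence_def G_def)
    then have "s \<in> map (relabel k \<pi>) ` lists G"
      by (simp only: lists_image[symmetric] in_lists_conv_set) blast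
    then obtain xs where xs: "set xs \<subseteq> G" "s = map (relabel k \<pi>) xs" by auto
    have "?mon (map (\<pi> j) (map (\<lambda>\<alpha>. \<alpha> j) xs))" if j: "j \<in> {1..k+1}" for j
    proof -
      have "map (\<lambda>\<alpha>. \<alpha> j) s = map (\<pi> j) (map (\<lambda>\<alpha>. \<alpha> j) xs)"
        unfolding xs(2) map_map by (rule map_cong[OF refl]) (simp only: o_apply relabel_apply[OF j])
      then show ?thesis using s(1) j unfolding monotone_subsequence_def by metis
    qed
    then have "\<pi> \<in> U xs" using \<pi> unfolding U_def by blast
    moreover have "xs \<in> T" using xs s(2) by (simp add: T_def)
    ultimately show "\<pi> \<in> (\<Union>xs\<in>T. U xs)" by blast
  qed
  then have "card {\<pi> \<in> relabellings k n. m \<le> longest_monotone k n (relabel_array k n \<pi> A)}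
      \<le> card (\<Union>xs\<in>T. U xs)"
    using finT finU by (intro card_mono) auto
  also have "\<dots> \<le> (\<Sum>xs\<in>T. card (U xs))"
    by (rule card_UN_le[OF finT])
  finally have "real (card {\<pi> \<in> relabellings k n. m \<le> longest_monotone k n (relabel_array k n \<pi> A)})
      \<le> (\<Sum>xs\<in>T. real (card (U xs)))"
    unfolding of_nat_sum[symmetric] of_nat_le_iff .
  also have "\<dots> \<le> (\<Sum>xs\<in>T. (2 / fact m) ^ (k + 1) * card (relabellings k n))"
    by (rule sum_mono[OF cU])
  finally show ?thesis by (simp add: cT mult.assoc)
qed

text \<open>\<open>m ^ m / fact m\<close> is one term of the exponential series at \<open>m\<close>,
  and e is at most 3.\<close>

lemma power_div_3_le_fact: "(real m / 3) ^ m \<le> fact m"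
proof -
  have "real m ^ m /\<^sub>R fact m \<le> (\<Sum>i. real m ^ i /\<^sub>R fact i)"
    using sum_le_suminf[OF summable_exp_generic[of "real m"], of "{m}"] by simp
  then have "real m ^ m / fact m \<le> exp (real m)"
    by (simp add: exp_def divide_inverse mult.commute)
  also have "exp (real m) = exp 1 ^ m" by (simp add: exp_of_nat_mult[symmetric])
  also have "\<dots> \<le> 3 ^ m" by (intro power_mono exp_le) simp
  finally show ?thesis by (simp add: power_divide field_simps)
qed

lemma prob_longest_monotone_gt:
  assumes k: "k \<ge> 1" and n: "n \<ge> 1"
  shows "measure_pmf.prob (random_hd_permutation k n)
    {A. 6 * real n powr (real k / real (k + 1)) < real (longest_monotone k n A)} \<le> 2 ^ (k + 1) / real n"
proof -
  define N where "N = real n powr (real k / real (k + 1))"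
  define m where "m = nat \<lceil>6 * N\<rceil>"
  have N0: "N > 0" using n by (simp add: N_def)
  have Nd: "N ^ (k + 1) = real n ^ k"
    unfolding N_def using n by (subst powr_power) (simp_all add: powr_realpow[symmetric])
  have m: "6 * N \<le> real m" unfolding m_def by linarith
  \<comment> \<open>The constant 6 is 3 times 2: the 3 is spent on the factorial estimate, and the 2
    leaves a gain of \<open>2 ^ m\<close>.\<close>
  have "(2 * N) ^ m \<le> (real m / 3) ^ m" using m N0 by (intro power_mono) auto
  also have "\<dots> \<le> fact m" by (rule power_div_3_le_fact)
  finally have f: "N ^ m / fact m \<le> 1 / 2 ^ m" by (simp add: field_simps power_mult_distrib)
  \<comment> \<open>The exponential gain is weakened to a factor \<open>n\<close>. This is enough
    later, because the longest monotone subsequence never exceeds \<open>n\<close>.\<close>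
  have "real n = real n ^ 1" by simp
  also have "\<dots> \<le> real n ^ k" using k n by (intro power_increasing) auto
  also have "\<dots> \<le> (2 ^ m) ^ (k + 1)"
  proof -
    have "N \<le> 2 ^ m" using m N0 of_nat_less_two_power[of m, where 'a = real] by linarith
    then show ?thesis unfolding Nd[symmetric] using N0 by (intro power_mono) auto
  qed
  finally have big: "real n \<le> (2 ^ m) ^ (k + 1)" .
  have "real n ^ (k * m) * (2 / fact m) ^ (k + 1) = (2 * (N ^ m / fact m)) ^ (k + 1)"
  proof -
    have "real n ^ (k * m) = (N ^ m) ^ (k + 1)"
      unfolding power_mult Nd[symmetric] by (simp only: power_mult[symmetric] mult.commute)
    then show ?thesis by (simp add: power_mult_distrib power_divide)
  qed
  also have "\<dots> \<le> (2 * (1 / 2 ^ m)) ^ (k + 1)"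
    using f N0 by (intro power_mono mult_left_mono) auto
  also have "\<dots> = 2 ^ (k + 1) / (2 ^ m) ^ (k + 1)"
    by (simp only: power_mult_distrib power_divide power_one times_divide_eq_right mult_1_right)
  also have "\<dots> \<le> 2 ^ (k + 1) / real n"
    using big n by (intro divide_left_mono) auto
  finally have bound: "real n ^ (k * m) * (2 / fact m) ^ (k + 1) \<le> 2 ^ (k + 1) / real n" .
  \<comment> \<open>As \<open>m\<close> is \<open>6 * N\<close> rounded up, an integer above
    \<open>6 * N\<close> is at least \<open>m\<close>.\<close>
  have "measure_pmf.prob (random_hd_permutation k n) {A. 6 * N < real (longest_monotone k n A)}
      \<le> measure_pmf.prob (random_hd_permutation k n) {A. m \<le> longest_monotone k n A}"
    by (intro measure_pmf.finite_measure_mono) (auto simp: m_def nat_le_iff ceiling_le_iff)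
  also have "\<dots> \<le> real n ^ (k * m) * (2 / fact m) ^ (k + 1)"
    by (intro prob_random_hd_permutation_le card_relabellings_longest_monotone_le n)
  finally show ?thesis using bound unfolding N_def by linarith
qed

subsection \<open>The two-dimensional case\<close>

text \<open>The Erdos--Szekeres argument: mapping each point to the lengths of the longest increasing and
  decreasing sequences ending there is injective.\<close>

lemma longest_monotone_square_ge:
  assumes A: "A \<in> hd_permutations 1 n" and n: "n \<ge> 1"
  shows "n \<le> (longest_monotone 1 n A)\<^sup>2"
proof -
  define G where "G = support 1 n A"
  define L where "L = longest_monotone 1 n A"
  \<comment> \<open>Coordinate 1 always increases; \<open>R\<close> is the direction of coordinate 2
    and will be \<open>(<)\<close> or \<open>(>)\<close>.\<close>
  define rel where "rel R = (\<lambda>(\<alpha> :: nat \<Rightarrow> nat) (\<beta> :: nat \<Rightarrow> nat). \<alpha> 1 < \<beta> 1 \<and> R (\<alpha> 2) (\<beta> 2))"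
    for R :: "nat \<Rightarrow> nat \<Rightarrow> bool"
  define S where "S R \<alpha> = {s. set s \<subseteq> G \<and> s \<noteq> [] \<and> last s = \<alpha> \<and> sorted_wrt (rel R) s}" for R \<alpha>
  define h where "h R \<alpha> = Max (length ` S R \<alpha>)" for R \<alpha>
  have bound: "length s \<le> L" if s: "s \<in> S R \<alpha>" and R: "R \<in> {(<), (>)}" for s R \<alpha>
  proof -
    have "sorted_wrt (<) (map (\<lambda>\<alpha>. \<alpha> 1) s)"
      using s by (auto simp: S_def rel_def sorted_wrt_map elim!: sorted_wrt_mono_rel[rotated])
    moreover have "sorted_wrt R (map (\<lambda>\<alpha>. \<alpha> 2) s)"
      using s by (auto simp: S_def rel_def sorted_wrt_map elim!: sorted_wrt_mono_rel[rotated])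
    moreover have "{1..1+1::nat} = {1, 2}" by auto
    ultimately have "monotone_subsequence 1 n A s"
      using s R by (auto simp: monotone_subsequence_def S_def G_def)
    then show ?thesis using longest_monotone_ge_iff L_def by blast
  qed
  have fin: "finite (length ` S R \<alpha>)" if "R \<in> {(<), (>)}" for R \<alpha>
  proof (rule finite_subset)
    show "length ` S R \<alpha> \<subseteq> {..L}" using bound[OF _ that] by blast
  qed simp
  have single: "[\<alpha>] \<in> S R \<alpha>" if "\<alpha> \<in> G" for R \<alpha>
    using that by (simp add: S_def)
  have h_ex: "\<exists>s\<in>S R \<alpha>. length s = h R \<alpha>" if "\<alpha> \<in> G" "R \<in> {(<), (>)}" for R \<alpha>
  proof -
    have "length ` S R \<alpha> \<noteq> {}" using single[OF that(1), of R] by blast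
    then have "h R \<alpha> \<in> length ` S R \<alpha>" unfolding h_def by (rule Max_in[OF fin[OF that(2)]])
    then show ?thesis by force
  qed
  have h_range: "h R \<alpha> \<in> {1..L}" if \<alpha>: "\<alpha> \<in> G" and R: "R \<in> {(<), (>)}" for R \<alpha>
  proof -
    obtain s where s: "s \<in> S R \<alpha>" "length s = h R \<alpha>" using h_ex[OF \<alpha> R] by blast
    have "s \<noteq> []" using s(1) by (simp add: S_def)
    then have "1 \<le> length s" by (simp add: Suc_le_eq)
    then show ?thesis using bound[OF s(1) R] unfolding s(2) by simp
  qed
  \<comment> \<open>Appending \<open>\<beta>\<close> to an optimal sequence ending in
    \<open>\<alpha>\<close> gives a longer one ending in \<open>\<beta>\<close>.\<close>
  have h_less: "h R \<alpha> < h R \<beta>"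
    if \<alpha>: "\<alpha> \<in> G" and \<beta>: "\<beta> \<in> G" and "\<alpha> 1 < \<beta> 1" "R (\<alpha> 2) (\<beta> 2)" and R: "R \<in> {(<), (>)}" for R \<alpha> \<beta>
  proof -
    obtain s where s: "s \<in> S R \<alpha>" "length s = h R \<alpha>" using h_ex[OF \<alpha> R] by blast
    have tr: "rel R \<gamma> \<beta>" if "rel R \<gamma> \<alpha>" for \<gamma>
      using that \<open>\<alpha> 1 < \<beta> 1\<close> \<open>R (\<alpha> 2) (\<beta> 2)\<close> R by (auto simp: rel_def)
    have s': "s = butlast s @ [\<alpha>]" using s(1) append_butlast_last_id[of s] by (simp add: S_def)
    have sw: "sorted_wrt (rel R) (butlast s @ [\<alpha>])" using s(1) s' by (simp add: S_def)
    have "rel R \<gamma> \<beta>" if "\<gamma> \<in> set s" for \<gamma>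
    proof -
      have "\<gamma> = \<alpha> \<or> \<gamma> \<in> set (butlast s)" using that by (subst (asm) s') auto
      then show ?thesis using tr sw \<open>\<alpha> 1 < \<beta> 1\<close> \<open>R (\<alpha> 2) (\<beta> 2)\<close>
        by (auto simp: sorted_wrt_append rel_def)
    qed
    then have "s @ [\<beta>] \<in> S R \<beta>"
      using s(1) \<beta> by (auto simp: S_def sorted_wrt_append)
    then have "length (s @ [\<beta>]) \<le> h R \<beta>" unfolding h_def by (intro Max_ge fin R imageI)
    then show ?thesis using s(2) by simp
  qed
  have coords: "{1..1+1::nat} = {1, 2}" by auto
  have "inj_on (\<lambda>\<alpha>. (h (<) \<alpha>, h (>) \<alpha>)) G"
  proof (rule inj_onI, rule ccontr)
    fix \<alpha> \<beta> assume \<alpha>: "\<alpha> \<in> G" and \<beta>: "\<beta> \<in> G" and ne: "\<alpha> \<noteq> \<beta>"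
      and eq: "(h (<) \<alpha>, h (>) \<alpha>) = (h (<) \<beta>, h (>) \<beta>)"
    \<comment> \<open>With two coordinates, support points that share one coordinate lie on a common
      line and coincide. Distinct points are thus strictly comparable in both coordinates, and one
      of the two labels must differ.\<close>
    have "\<alpha> 1 \<noteq> \<beta> 1" "\<alpha> 2 \<noteq> \<beta> 2"
      using support_unique[OF A, of 2 \<alpha> \<beta>] support_unique[OF A, of 1 \<alpha> \<beta>] \<alpha> \<beta> ne
      unfolding G_def coords by auto
    then consider "\<alpha> 1 < \<beta> 1" "\<alpha> 2 < \<beta> 2" | "\<alpha> 1 < \<beta> 1" "\<alpha> 2 > \<beta> 2"
      | "\<beta> 1 < \<alpha> 1" "\<beta> 2 < \<alpha> 2" | "\<beta> 1 < \<alpha> 1" "\<beta> 2 > \<alpha> 2" by linarith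
    then show False
      by cases (use h_less[OF \<alpha> \<beta>, of "(<)"] h_less[OF \<alpha> \<beta>, of "(>)"]
          h_less[OF \<beta> \<alpha>, of "(<)"] h_less[OF \<beta> \<alpha>, of "(>)"] eq in auto)
  qed
  moreover have "(\<lambda>\<alpha>. (h (<) \<alpha>, h (>) \<alpha>)) ` G \<subseteq> {1..L} \<times> {1..L}"
    using h_range by blast
  ultimately have "card G \<le> card ({1..L} \<times> {1..L})"
    by (intro card_inj_on_le) auto
  then show ?thesis
    using card_support[OF A n] by (simp add: G_def L_def card_cartesian_product power2_eq_square)
qed

subsection \<open>Nonempty boxes\<close>

text \<open>The same \<open>I\<close> is used in every coordinate: the box is a cube on the
  diagonal. It is phrased through points of the original support, so that \<open>A\<close> stays
  fixed while \<open>\<pi>\<close> varies.\<close>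

definition box_hits :: "nat \<Rightarrow> nat \<Rightarrow> ((nat \<Rightarrow> nat) \<Rightarrow> nat) \<Rightarrow> nat set \<Rightarrow> (nat \<Rightarrow> nat \<Rightarrow> nat) set" where
  "box_hits k n A I =
    {\<pi> \<in> relabellings k n. \<exists>\<beta>\<in>support k n A. \<forall>j\<in>{1..k+1}. \<pi> j (\<beta> j) \<in> I}"

text \<open>Second moment method: a pair of points of the support agreeing exactly on the
  coordinates \<open>E\<close> lies in the box with probability about \<open>(s / n) ^ (2 * (k + 1) - card E)\<close>.\<close>

lemma card_box_hits_ge:
  assumes A: "A \<in> hd_permutations k n" and n: "n \<ge> 2" and I: "I \<subseteq> {1..n}"
    and s: "card I \<ge> 1" "card I ^ (k + 1) \<le> n"
  shows "real (card (box_hits k n A I))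
    \<ge> real (card I) ^ (k + 1) / real n / 4 ^ (k + 1) * card (relabellings k n)"
proof -
  define J where "J = {1..k+1}"
  define G where "G = support k n A"
  define P where "P = relabellings k n"
  define C where "C = real (card P)"
  \<comment> \<open>\<open>c\<close> is the probability that a given coordinate of a given point
    lands in \<open>I\<close>. The number \<open>Y\<close> of support points in the box has mean
    \<open>lam\<close>, which equals \<open>n ^ k * c ^ (k + 1)\<close>.\<close>
  define c where "c = real (card I) / real n"
  define lam where "lam = real (card I) ^ (k + 1) / real n"
  define B where "B \<pi> \<beta> \<longleftrightarrow> (\<forall>j\<in>J. \<pi> j (\<beta> j) \<in> I)" for \<pi> :: "nat \<Rightarrow> nat \<Rightarrow> nat" and \<beta> :: "nat \<Rightarrow> nat"
  define Y where "Y \<pi> = (\<Sum>\<beta>\<in>G. of_bool (B \<pi> \<beta>) :: real)" for \<pi>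
  have finP: "finite P" unfolding P_def by (rule finite_relabellings)
  have finG: "finite G" unfolding G_def by (rule finite_support)
  have cJ: "card J = k + 1" "finite J" by (simp_all add: J_def)
  have CP: "C = fact n ^ (k + 1)" by (simp add: C_def P_def card_relabellings)
  have C0: "C > 0" by (simp add: CP)
  have lam0: "lam > 0" using s(1) n by (simp add: lam_def)
  have c0: "c \<ge> 0" by (simp add: c_def)
  have cG: "real (card G) = real n ^ k"
    using card_support[OF A] n by (simp add: G_def)
  have lamc: "real n ^ k * c ^ (k + 1) = lam"
    using n by (simp add: c_def lam_def field_simps power_add)
  have Gin: "\<beta> j \<in> {1..n}" if "\<beta> \<in> G" "j \<in> J" for \<beta> j
    using that unfolding G_def J_def support_def positions_def by (blast dest: PiE_mem)

  have "(\<Sum>\<pi>\<in>P. Y \<pi>) = (\<Sum>\<beta>\<in>G. \<Sum>\<pi>\<in>P. of_bool (B \<pi> \<beta>))"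
    unfolding Y_def by (rule sum.swap)
  also have "\<dots> = (\<Sum>\<beta>\<in>G. c ^ (k + 1) * C)"
  proof (rule sum.cong[OF refl])
    fix \<beta> assume \<beta>: "\<beta> \<in> G"
    have "(\<Sum>\<pi>\<in>P. of_bool (B \<pi> \<beta>)) = real (card {\<pi> \<in> relabellings k n. \<forall>j\<in>{1..k+1}. \<pi> j (\<beta> j) \<in> I})"
      unfolding real_card_eq_sum_of_bool[OF finP, symmetric] by (simp only: P_def B_def J_def)
    also have "\<dots> = (\<Prod>j\<in>{1..k+1}. real (card {p. p permutes {1..n} \<and> p (\<beta> j) \<in> I}))"
      using card_relabellings_PiE[of k n "\<lambda>j p. p (\<beta> j) \<in> I"] by (simp only: of_nat_prod)
    also have "\<dots> = (\<Prod>j\<in>{1..k+1}. c * fact n)"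
    proof (rule prod.cong[OF refl])
      fix j assume "j \<in> {1..k+1}"
      then show "real (card {p. p permutes {1..n} \<and> p (\<beta> j) \<in> I}) = c * fact n"
        using card_permutes_hit[OF finite_atLeastAtMost Gin[OF \<beta>, of j] I] by (simp add: J_def c_def)
    qed
    finally show "(\<Sum>\<pi>\<in>P. of_bool (B \<pi> \<beta>)) = c ^ (k + 1) * C"
      by (simp add: CP power_mult_distrib)
  qed
  also have "\<dots> = lam * C" using cG lamc by simp
  finally have EY: "(\<Sum>\<pi>\<in>P. Y \<pi>) = lam * C" .

  have pair: "(\<Sum>\<pi>\<in>P. of_bool (B \<pi> \<beta>) * of_bool (B \<pi> \<gamma>))
      \<le> c ^ (k + 1) * C * (\<Prod>j\<in>J. of_bool (\<beta> j = \<gamma> j) + 2 * c)"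
    if \<beta>: "\<beta> \<in> G" and \<gamma>: "\<gamma> \<in> G" for \<beta> \<gamma>
  proof -
    have "(\<Sum>\<pi>\<in>P. of_bool (B \<pi> \<beta>) * of_bool (B \<pi> \<gamma>))
        = (\<Sum>\<pi>\<in>P. of_bool (\<forall>j\<in>{1..k+1}. \<pi> j (\<beta> j) \<in> I \<and> \<pi> j (\<gamma> j) \<in> I) :: real)"
      by (intro sum.cong) (auto simp: B_def J_def)
    also have "\<dots> = real (card {\<pi> \<in> relabellings k n. \<forall>j\<in>{1..k+1}. \<pi> j (\<beta> j) \<in> I \<and> \<pi> j (\<gamma> j) \<in> I})"
      unfolding real_card_eq_sum_of_bool[OF finP, symmetric] by (simp only: P_def)
    also have "\<dots> = (\<Prod>j\<in>J. real (card {p. p permutes {1..n} \<and> p (\<beta> j) \<in> I \<and> p (\<gamma> j) \<in> I}))"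
      using card_relabellings_PiE[of k n "\<lambda>j p. p (\<beta> j) \<in> I \<and> p (\<gamma> j) \<in> I"]
      by (simp only: of_nat_prod J_def)
    also have "\<dots> \<le> (\<Prod>j\<in>J. c * fact n * (of_bool (\<beta> j = \<gamma> j) + 2 * c))"
    proof (intro prod_mono conjI of_nat_0_le_iff)
      fix j assume j: "j \<in> J"
      have "card {1..n} \<ge> 2" using n by simp
      from card_permutes_hit2_le[OF finite_atLeastAtMost this Gin[OF \<beta> j] Gin[OF \<gamma> j] I]
      show "real (card {p. p permutes {1..n} \<and> p (\<beta> j) \<in> I \<and> p (\<gamma> j) \<in> I})
          \<le> c * fact n * (of_bool (\<beta> j = \<gamma> j) + 2 * c)"
        by (simp add: c_def of_bool_def mult_ac split: if_splits)
    qed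
    also have "\<dots> = c ^ (k + 1) * C * (\<Prod>j\<in>J. of_bool (\<beta> j = \<gamma> j) + 2 * c)"
      by (simp only: prod.distrib prod_constant cJ CP)
    finally show ?thesis .
  qed
  \<comment> \<open>Multiplying out the product gives one term for each set \<open>E\<close> of
    coordinates on which \<open>\<beta>\<close> and \<open>\<gamma>\<close> agree. Each of the
    \<open>2 ^ (k + 1)\<close> sets contributes at most \<open>2 ^ (k + 1)\<close>.\<close>
  have agree: "(\<Sum>\<gamma>\<in>G. \<Prod>j\<in>J. of_bool (\<beta> j = \<gamma> j) + 2 * c) \<le> 4 ^ (k + 1)" if \<beta>: "\<beta> \<in> G" for \<beta>
  proof -
    have "(\<Sum>\<gamma>\<in>G. \<Prod>j\<in>J. of_bool (\<beta> j = \<gamma> j) + 2 * c)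
        = (\<Sum>\<gamma>\<in>G. \<Sum>E\<in>Pow J. of_bool (\<forall>j\<in>E. \<gamma> j = \<beta> j) * (2 * c) ^ card (J - E))"
    proof (rule sum.cong[OF refl])
      fix \<gamma>
      have "(\<Prod>j\<in>E. of_bool (\<beta> j = \<gamma> j) :: real) = of_bool (\<forall>j\<in>E. \<gamma> j = \<beta> j)" if "E \<in> Pow J" for E
      proof -
        have "finite E" using that cJ(2) finite_subset by blast
        then show ?thesis by (induction E rule: finite_induct) auto
      qed
      then show "(\<Prod>j\<in>J. of_bool (\<beta> j = \<gamma> j) + 2 * c)
          = (\<Sum>E\<in>Pow J. of_bool (\<forall>j\<in>E. \<gamma> j = \<beta> j) * (2 * c) ^ card (J - E))"
        unfolding prod_add[OF cJ(2)] by (intro sum.cong) auto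
    qed
    also have "\<dots> = (\<Sum>E\<in>Pow J. real (card {\<gamma>\<in>G. \<forall>j\<in>E. \<gamma> j = \<beta> j}) * (2 * c) ^ card (J - E))"
      by (subst sum.swap) (simp add: real_card_eq_sum_of_bool[OF finG] sum_distrib_right)
    also have "\<dots> \<le> (\<Sum>E\<in>Pow J. 2 ^ (k + 1))"
    proof (rule sum_mono)
      fix E assume E: "E \<in> Pow J"
      show "real (card {\<gamma>\<in>G. \<forall>j\<in>E. \<gamma> j = \<beta> j}) * (2 * c) ^ card (J - E) \<le> 2 ^ (k + 1)"
      proof (cases "E = J")
        case True
        have "{\<gamma>\<in>G. \<forall>j\<in>E. \<gamma> j = \<beta> j} \<subseteq> {\<beta>}"
        proof
          fix \<gamma> assume "\<gamma> \<in> {\<gamma>\<in>G. \<forall>j\<in>E. \<gamma> j = \<beta> j}"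
          then show "\<gamma> \<in> {\<beta>}"
            using support_unique[OF A, of 1 \<gamma> \<beta>] \<beta> by (auto simp: G_def J_def True)
        qed
        then have "card {\<gamma>\<in>G. \<forall>j\<in>E. \<gamma> j = \<beta> j} \<le> card {\<beta>}" by (intro card_mono) auto
        moreover have "(1::real) \<le> 2 ^ (k + 1)" by (rule one_le_power) simp
        ultimately show ?thesis using True by simp
      next
        case False
        then have ss: "E \<subset> {1..k+1}" using E by (auto simp: J_def)
        define e where "e = card E"
        have e: "e \<le> k"
          using psubset_card_mono[OF _ ss] by (simp add: e_def)
        have cE: "card (J - E) = k + 1 - e"
          using E cJ finite_subset[of E J] by (simp add: card_Diff_subset e_def)
        have "real (card {\<gamma>\<in>G. \<forall>j\<in>E. \<gamma> j = \<beta> j}) \<le> real n ^ (k - e)"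
          using card_support_agree_le[OF A ss, of \<beta>]
          unfolding G_def e_def of_nat_power[symmetric] of_nat_le_iff .
        then have "real (card {\<gamma>\<in>G. \<forall>j\<in>E. \<gamma> j = \<beta> j}) * (2 * c) ^ card (J - E)
            \<le> real n ^ (k - e) * (2 * c) ^ (k + 1 - e)"
          unfolding cE using c0 by (intro mult_right_mono) auto
        also have "\<dots> = 2 ^ (k + 1 - e) * (real (card I) ^ (k + 1 - e) / real n)"
        proof -
          have "k + 1 - e = Suc (k - e)" using e by simp
          then show ?thesis
            using n by (simp only: c_def power_mult_distrib power_divide power_Suc) simp
        qed
        \<comment> \<open>The hypothesis \<open>card I ^ (k + 1) \<le> n\<close> enters here: with
          at most about one expected point in the box, no proper set \<open>E\<close> dominates the
          second moment.\<close>
        also have "\<dots> \<le> 2 ^ (k + 1) * 1"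
        proof (intro mult_mono power_increasing)
          have "real (card I) ^ (k + 1 - e) \<le> real (card I) ^ (k + 1)"
            using s(1) by (intro power_increasing) auto
          also have "\<dots> \<le> real n" using s(2) unfolding of_nat_power[symmetric] of_nat_le_iff .
          finally show "real (card I) ^ (k + 1 - e) / real n \<le> 1" using n by simp
        qed auto
        finally show ?thesis by simp
      qed
    qed
    also have "\<dots> = 4 ^ (k + 1)"
      using cJ by (simp add: card_Pow power_mult_distrib[symmetric])
    finally show ?thesis .
  qed
  have "(\<Sum>\<pi>\<in>P. (Y \<pi>)\<^sup>2) = (\<Sum>\<beta>\<in>G. \<Sum>\<gamma>\<in>G. \<Sum>\<pi>\<in>P. of_bool (B \<pi> \<beta>) * of_bool (B \<pi> \<gamma>))"
    unfolding Y_def power2_eq_square sum_product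
    by (subst sum.swap, rule sum.cong[OF refl], rule sum.swap)
  also have "\<dots> \<le> (\<Sum>\<beta>\<in>G. \<Sum>\<gamma>\<in>G. c ^ (k + 1) * C * (\<Prod>j\<in>J. of_bool (\<beta> j = \<gamma> j) + 2 * c))"
    by (intro sum_mono pair)
  also have "\<dots> = (\<Sum>\<beta>\<in>G. c ^ (k + 1) * C * (\<Sum>\<gamma>\<in>G. \<Prod>j\<in>J. of_bool (\<beta> j = \<gamma> j) + 2 * c))"
    by (simp only: sum_distrib_left)
  also have "\<dots> \<le> (\<Sum>\<beta>\<in>G. c ^ (k + 1) * C * 4 ^ (k + 1))"
    using c0 C0 by (intro sum_mono mult_left_mono agree) auto
  also have "\<dots> = lam * C * 4 ^ (k + 1)"
    using cG lamc by simp
  finally have EY2: "(\<Sum>\<pi>\<in>P. (Y \<pi>)\<^sup>2) \<le> lam * C * 4 ^ (k + 1)" .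

  define Q where "Q = box_hits k n A I"
  \<comment> \<open>\<open>Y\<close> vanishes off \<open>Q\<close>, so Cauchy-Schwarz bounds the
    squared mean of \<open>Y\<close> by the probability of \<open>Q\<close> times the second
    moment.\<close>
  have "Y \<pi> = of_bool (\<pi> \<in> Q) * Y \<pi>" if "\<pi> \<in> P" for \<pi>
    using that by (auto simp: Y_def Q_def box_hits_def P_def G_def B_def J_def intro!: sum.neutral)
  then have "(lam * C)\<^sup>2 = (\<Sum>\<pi>\<in>P. of_bool (\<pi> \<in> Q) * Y \<pi>)\<^sup>2"
    unfolding EY[symmetric] by (metis (no_types, lifting) sum.cong)
  also have "\<dots> \<le> (\<Sum>\<pi>\<in>P. (of_bool (\<pi> \<in> Q))\<^sup>2) * (\<Sum>\<pi>\<in>P. (Y \<pi>)\<^sup>2)"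
    by (rule Cauchy_Schwarz_ineq_sum)
  also have "(\<Sum>\<pi>\<in>P. (of_bool (\<pi> \<in> Q))\<^sup>2) = real (card {\<pi> \<in> P. \<pi> \<in> Q})"
    unfolding real_card_eq_sum_of_bool[OF finP] by (intro sum.cong) auto
  also have "{\<pi> \<in> P. \<pi> \<in> Q} = Q" by (auto simp: Q_def P_def box_hits_def)
  also have "real (card Q) * (\<Sum>\<pi>\<in>P. (Y \<pi>)\<^sup>2) \<le> real (card Q) * (lam * C * 4 ^ (k + 1))"
    using EY2 by (intro mult_left_mono) auto
  finally have "lam * C * (lam * C) \<le> lam * C * (real (card Q) * 4 ^ (k + 1))"
    by (simp add: power2_eq_square mult_ac)
  then have "lam * C \<le> real (card Q) * 4 ^ (k + 1)"
    using lam0 C0 by (simp del: power_Suc)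
  then have "lam / 4 ^ (k + 1) * C \<le> real (card Q)"
    by (simp only: times_divide_eq_left pos_divide_le_eq zero_less_power zero_less_numeral)
  then show ?thesis
    unfolding lam_def C_def P_def Q_def .
qed

section \<open>Near-independence of disjoint boxes\<close>

text \<open>Prescribing the inverse of \<open>\<sigma> j\<close> on \<open>I\<close> prescribes
  \<open>\<sigma> j\<close> on \<open>card I\<close> points, which leaves
  \<open>fact (n - card I)\<close> choices in each coordinate.\<close>

lemma card_relabellings_agree:
  assumes \<pi>: "\<pi> \<in> relabellings k n" and I: "I \<subseteq> {1..n}"
  shows "card {\<sigma> \<in> relabellings k n. \<forall>j\<in>{1..k+1}. \<forall>u\<in>I. inv (\<sigma> j) u = inv (\<pi> j) u}
    = fact (n - card I) ^ (k + 1)"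
proof -
  have "inv (\<sigma> j) u = inv (\<pi> j) u \<longleftrightarrow> \<sigma> j (inv (\<pi> j) u) = u"
    if "\<sigma> \<in> relabellings k n" "j \<in> {1..k+1}" for \<sigma> j u
    by (rule permutes_inv_eq[OF relabellings_permutes[OF that]])
  then have "{\<sigma> \<in> relabellings k n. \<forall>j\<in>{1..k+1}. \<forall>u\<in>I. inv (\<sigma> j) u = inv (\<pi> j) u}
      = {\<sigma> \<in> relabellings k n. \<forall>j\<in>{1..k+1}. \<forall>u\<in>I. \<sigma> j (inv (\<pi> j) u) = u}"
    by blast
  also have "card \<dots> = (\<Prod>j\<in>{1..k+1}. card {p. p permutes {1..n} \<and> (\<forall>u\<in>I. p (inv (\<pi> j) u) = u)})"
    by (rule card_relabellings_PiE)
  also have "\<dots> = (\<Prod>j\<in>{1..k+1}. fact (n - card I))"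
  proof (rule prod.cong[OF refl])
    fix j assume "j \<in> {1..k+1}"
    then have perm: "inv (\<pi> j) permutes {1..n}"
      using relabellings_permutes[OF \<pi>] permutes_inv by blast
    then have "inj_on (inv (\<pi> j)) I" "inv (\<pi> j) ` I \<subseteq> {1..n}"
      using I permutes_in_image[OF perm] by (auto intro: inj_on_subset[OF permutes_inj])
    then show "card {p. p permutes {1..n} \<and> (\<forall>u\<in>I. p (inv (\<pi> j) u) = u)} = fact (n - card I)"
      using card_permutes_extending[of "{1..n}" "inv (\<pi> j)" I "\<lambda>u. u"] I by simp
  qed
  finally show ?thesis by simp
qed

text \<open>The support point that witnesses the hit for \<open>\<pi>\<close> also serves
  \<open>\<sigma>\<close>: its coordinates are preimages of elements of \<open>I\<close>, and these
  preimages agree.\<close>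

lemma box_hits_agree:
  assumes \<pi>: "\<pi> \<in> box_hits k n A I" and \<sigma>: "\<sigma> \<in> relabellings k n"
    and eq: "\<forall>j\<in>{1..k+1}. \<forall>u\<in>I. inv (\<sigma> j) u = inv (\<pi> j) u"
  shows "\<sigma> \<in> box_hits k n A I"
proof -
  obtain \<beta> where \<beta>: "\<beta> \<in> support k n A" "\<forall>j\<in>{1..k+1}. \<pi> j (\<beta> j) \<in> I"
    using \<pi> unfolding box_hits_def by blast
  have "\<sigma> j (\<beta> j) \<in> I" if j: "j \<in> {1..k+1}" for j
  proof -
    have "\<pi> j permutes {1..n}" using \<pi> j relabellings_permutes unfolding box_hits_def by blast
    then have "inv (\<sigma> j) (\<pi> j (\<beta> j)) = \<beta> j"
      using eq \<beta>(2) j permutes_inverses(2) by metis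
    then have "\<sigma> j (\<beta> j) = \<pi> j (\<beta> j)"
      using permutes_inv_eq[OF relabellings_permutes[OF \<sigma> j]] by blast
    then show ?thesis using \<beta>(2) j by simp
  qed
  then show ?thesis using \<sigma> \<beta>(1) unfolding box_hits_def by blast
qed

text \<open>Whether a relabelling hits a box \<open>I\<close> depends only on its inverses restricted to \<open>I\<close>. For
  disjoint \<open>I\<close> and \<open>I'\<close> the joint law of the two restrictions has bounded density with respect to
  the product of their laws.\<close>

lemma card_box_hits_Int_le:
  assumes I: "I \<subseteq> {1..n}" "card I = s" and I': "I' \<subseteq> {1..n}" "card I' = s" and disj: "I \<inter> I' = {}"
  shows "real (card (box_hits k n A I \<inter> box_hits k n A I')) * card (relabellings k n)
    \<le> (fact n * fact (n - 2 * s) / (fact (n - s))\<^sup>2) ^ (k + 1)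
      * card (box_hits k n A I) * card (box_hits k n A I')"
proof -
  define P where "P = relabellings k n"
  define Q where "Q = box_hits k n A I"
  define Q' where "Q' = box_hits k n A I'"
  define \<Phi> where "\<Phi> I \<pi> = (\<lambda>j\<in>{1..k+1}. restrict (inv (\<pi> j)) I)"
    for I :: "nat set" and \<pi> :: "nat \<Rightarrow> nat \<Rightarrow> nat"
  have \<Phi>_eq: "\<Phi> I \<sigma> = \<Phi> I \<pi> \<longleftrightarrow> (\<forall>j\<in>{1..k+1}. \<forall>u\<in>I. inv (\<sigma> j) u = inv (\<pi> j) u)" for I \<sigma> \<pi>
  proof
    assume eq: "\<Phi> I \<sigma> = \<Phi> I \<pi>"
    show "\<forall>j\<in>{1..k+1}. \<forall>u\<in>I. inv (\<sigma> j) u = inv (\<pi> j) u"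
    proof (intro ballI)
      fix j u assume "j \<in> {1..k+1}" "u \<in> I"
      then show "inv (\<sigma> j) u = inv (\<pi> j) u"
        using fun_cong[OF fun_cong[OF eq, of j], of u] by (simp only: \<Phi>_def restrict_apply')
    qed
  next
    assume eq: "\<forall>j\<in>{1..k+1}. \<forall>u\<in>I. inv (\<sigma> j) u = inv (\<pi> j) u"
    show "\<Phi> I \<sigma> = \<Phi> I \<pi>"
      unfolding \<Phi>_def by (intro restrict_ext) (use eq in blast)
  qed
  have QP: "Q \<subseteq> P" "Q' \<subseteq> P" by (auto simp: Q_def Q'_def P_def box_hits_def)
  have finP: "finite P" unfolding P_def by (rule finite_relabellings)
  have finQ: "finite Q" "finite Q'" using QP finP finite_subset by blast+
  \<comment> \<open>By \<open>box_hits_agree\<close> the set is a union of complete fibres of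
    \<open>\<Phi> I\<close>, all of the same size. The exact equality is needed to turn image sizes
    back into set sizes at the end.\<close>
  have single: "card (box_hits k n A I) = card (\<Phi> I ` box_hits k n A I) * fact (n - s) ^ (k + 1)"
    if I: "I \<subseteq> {1..n}" "card I = s" for I
  proof -
    let ?Q = "box_hits k n A I"
    have fin: "finite ?Q" using finite_relabellings[of k n] by (simp add: box_hits_def)
    have "card ?Q = (\<Sum>f\<in>\<Phi> I ` ?Q. card {\<sigma> \<in> ?Q. \<Phi> I \<sigma> = f})"
      using sum.image_gen[OF fin, of "\<lambda>_. 1::nat" "\<Phi> I"] by simp
    also have "\<dots> = (\<Sum>f\<in>\<Phi> I ` ?Q. fact (n - s) ^ (k + 1))"
    proof (rule sum.cong[OF refl])
      fix f assume "f \<in> \<Phi> I ` ?Q"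
      then obtain \<pi> where \<pi>: "\<pi> \<in> ?Q" "f = \<Phi> I \<pi>" by blast
      have "{\<sigma> \<in> ?Q. \<Phi> I \<sigma> = f}
          = {\<sigma> \<in> relabellings k n. \<forall>j\<in>{1..k+1}. \<forall>u\<in>I. inv (\<sigma> j) u = inv (\<pi> j) u}"
        unfolding \<pi>(2) \<Phi>_eq using box_hits_agree[OF \<pi>(1)] by (auto simp: box_hits_def)
      moreover have "\<pi> \<in> relabellings k n" using \<pi>(1) by (simp add: box_hits_def)
      ultimately show "card {\<sigma> \<in> ?Q. \<Phi> I \<sigma> = f} = fact (n - s) ^ (k + 1)"
        using card_relabellings_agree[OF _ I(1), of \<pi>] I(2) by simp
    qed
    finally show ?thesis by simp
  qed
  define g where "g \<pi> = (\<Phi> I \<pi>, \<Phi> I' \<pi>)" for \<pi>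
  have "card (Q \<inter> Q') = (\<Sum>f\<in>g ` (Q \<inter> Q'). card {\<sigma> \<in> Q \<inter> Q'. g \<sigma> = f})"
    using sum.image_gen[of "Q \<inter> Q'" "\<lambda>_. 1::nat" g] finQ by simp
  \<comment> \<open>For the joint restriction an upper bound on the fibres suffices. A fibre fixes
    \<open>2 * s\<close> values per coordinate because \<open>I\<close> and \<open>I'\<close> are
    disjoint.\<close>
  also have "\<dots> \<le> (\<Sum>f\<in>g ` (Q \<inter> Q'). fact (n - 2 * s) ^ (k + 1))"
  proof (rule sum_mono)
    fix f assume "f \<in> g ` (Q \<inter> Q')"
    then obtain \<pi> where \<pi>: "\<pi> \<in> Q" "\<pi> \<in> Q'" "f = g \<pi>" by blast
    have "{\<sigma> \<in> Q \<inter> Q'. g \<sigma> = f}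
        \<subseteq> {\<sigma> \<in> P. \<forall>j\<in>{1..k+1}. \<forall>u\<in>I \<union> I'. inv (\<sigma> j) u = inv (\<pi> j) u}"
      unfolding \<pi>(3) g_def prod.inject \<Phi>_eq using QP by blast
    then have "card {\<sigma> \<in> Q \<inter> Q'. g \<sigma> = f}
        \<le> card {\<sigma> \<in> P. \<forall>j\<in>{1..k+1}. \<forall>u\<in>I \<union> I'. inv (\<sigma> j) u = inv (\<pi> j) u}"
      by (rule card_mono[rotated]) (simp add: finP)
    also have "\<dots> = fact (n - card (I \<union> I')) ^ (k + 1)"
      unfolding P_def using \<pi>(1) QP I(1) I'(1) by (intro card_relabellings_agree) (auto simp: P_def)
    also have "card (I \<union> I') = 2 * s"
      using I I' disj finite_subset[of _ "{1..n}"] by (simp add: card_Un_disjoint)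
    finally show "card {\<sigma> \<in> Q \<inter> Q'. g \<sigma> = f} \<le> fact (n - 2 * s) ^ (k + 1)" .
  qed
  also have "\<dots> = card (g ` (Q \<inter> Q')) * fact (n - 2 * s) ^ (k + 1)" by simp
  \<comment> \<open>Pairs of restrictions that occur together are among the pairs whose components
    occur separately.\<close>
  also have "card (g ` (Q \<inter> Q')) \<le> card (\<Phi> I ` Q \<times> \<Phi> I' ` Q')"
    using finQ by (intro card_mono) (auto simp: g_def)
  finally have joint: "card (Q \<inter> Q') \<le> card (\<Phi> I ` Q) * card (\<Phi> I' ` Q') * fact (n - 2 * s) ^ (k + 1)"
    by (simp add: card_cartesian_product)
  define a b where "a = real (card (\<Phi> I ` Q))" and "b = real (card (\<Phi> I' ` Q'))"
  define u v w :: real where "u = fact n ^ (k + 1)" and "v = fact (n - s) ^ (k + 1)"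
    and "w = fact (n - 2 * s) ^ (k + 1)"
  have ca: "real (card Q) = a * v" "real (card Q') = b * v"
    using single[OF I] single[OF I'] by (simp_all add: a_def b_def v_def Q_def Q'_def)
  have "real (card (Q \<inter> Q')) \<le> real (card (\<Phi> I ` Q) * card (\<Phi> I' ` Q') * fact (n - 2 * s) ^ (k + 1))"
    using joint by (rule of_nat_mono)
  then have "real (card (Q \<inter> Q')) * u \<le> a * b * w * u"
    by (intro mult_right_mono) (simp_all add: a_def b_def w_def u_def)
  also have "\<dots> = u * w / (v * v) * (a * v) * (b * v)"
    by (simp add: v_def field_simps)
  also have "u * w / (v * v) = (fact n * fact (n - 2 * s) / (fact (n - s))\<^sup>2) ^ (k + 1)"
    by (simp only: u_def v_def w_def power_mult_distrib power_divide power2_eq_square)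
  finally show ?thesis
    unfolding ca[symmetric] Q_def Q'_def by (simp add: u_def card_relabellings)
qed

section \<open>Concentration of the number of hit boxes\<close>

text \<open>Chebyshev's inequality for the number of sets \<open>Q i\<close> that contain a random
  \<open>x\<close>. If pairs are correlated by a factor at most \<open>r\<close>, the variance is at
  most \<open>\<mu> + (r - 1) * \<mu>^2\<close>; a deviation of \<open>\<mu> / 2\<close> brings in
  the factor 4.\<close>

lemma card_few_hits_le:
  fixes Q :: "'i \<Rightarrow> 'a set" and r :: real
  assumes P: "finite P" "P \<noteq> {}" and T: "finite T" and QP: "\<And>i. i \<in> T \<Longrightarrow> Q i \<subseteq> P"
    and pair: "\<And>i j. i \<in> T \<Longrightarrow> j \<in> T \<Longrightarrow> i \<noteq> j \<Longrightarrow>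
      real (card (Q i \<inter> Q j)) * card P \<le> r * card (Q i) * card (Q j)"
    and r: "r \<ge> 0"
    and \<mu>: "\<mu> = (\<Sum>i\<in>T. real (card (Q i)) / card P)" "\<mu> > 0"
  shows "real (card {x \<in> P. real (card {i \<in> T. x \<in> Q i}) < \<mu> / 2}) \<le> 4 * (1 / \<mu> + (r - 1)) * card P"
proof -
  define C where "C = real (card P)"
  have C0: "C > 0" using P by (simp add: C_def card_gt_0_iff)
  define X where "X x = real (card {i \<in> T. x \<in> Q i})" for x
  have X: "X x = (\<Sum>i\<in>T. of_bool (x \<in> Q i))" for x
    unfolding X_def by (rule real_card_eq_sum_of_bool[OF T])
  have cQ: "(\<Sum>x\<in>P. of_bool (x \<in> Q i)) = real (card (Q i))" if "i \<in> T" for i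
    using QP[OF that] by (subst real_card_eq_sum_of_bool[OF P(1), symmetric]) (simp add: Int_def[symmetric] Int_absorb1)
  have "(\<Sum>x\<in>P. X x) = (\<Sum>i\<in>T. real (card (Q i)))"
    unfolding X by (subst sum.swap) (simp add: cQ)
  also have "\<dots> = C * \<mu>"
    using C0 by (simp add: \<mu>(1) sum_distrib_left C_def)
  finally have S1: "(\<Sum>x\<in>P. X x) = C * \<mu>" .
  define p where "p i = real (card (Q i)) / C" for i
  have \<mu>p: "\<mu> = (\<Sum>i\<in>T. p i)" by (simp add: \<mu>(1) p_def C_def)
  have p0: "p i \<ge> 0" for i using C0 by (simp add: p_def)
  have "(\<Sum>x\<in>P. (X x)\<^sup>2) = (\<Sum>i\<in>T. \<Sum>j\<in>T. \<Sum>x\<in>P. of_bool (x \<in> Q i) * of_bool (x \<in> Q j))"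
    unfolding X power2_eq_square sum_product
    by (subst sum.swap, rule sum.cong[OF refl], rule sum.swap)
  \<comment> \<open>The product term is added on the diagonal too, where it is nonnegative, so that
    the double sum factors into \<open>\<mu>\<close> squared.\<close>
  also have "\<dots> \<le> (\<Sum>i\<in>T. \<Sum>j\<in>T. (if i = j then C * p i else 0) + r * C * p i * p j)"
  proof (intro sum_mono)
    fix i j assume i: "i \<in> T" and j: "j \<in> T"
    have "(\<Sum>x\<in>P. of_bool (x \<in> Q i) * of_bool (x \<in> Q j)) = (\<Sum>x\<in>P. of_bool (x \<in> Q i \<inter> Q j) :: real)"
      by (intro sum.cong) auto
    also have "\<dots> = real (card (Q i \<inter> Q j))"
      using QP[OF i] by (subst real_card_eq_sum_of_bool[OF P(1), symmetric]) (rule arg_cong[of _ _ "\<lambda>x. real (card x)"], auto)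
    also have "\<dots> \<le> (if i = j then C * p i else 0) + r * C * p i * p j"
    proof (cases "i = j")
      case True
      have "0 \<le> r * C * p i * p j" using r C0 p0 by (intro mult_nonneg_nonneg) auto
      then show ?thesis using True C0 by (simp add: p_def)
    next
      case False
      then show ?thesis using pair[OF i j False] C0 by (simp add: p_def C_def[symmetric] field_simps)
    qed
    finally show "(\<Sum>x\<in>P. of_bool (x \<in> Q i) * of_bool (x \<in> Q j))
        \<le> (if i = j then C * p i else 0) + r * C * p i * p j" .
  qed
  also have "\<dots> = C * \<mu> + r * C * \<mu>\<^sup>2"
  proof -
    have "(\<Sum>i\<in>T. \<Sum>j\<in>T. if i = j then C * p i else 0) = C * \<mu>"
      using T by (simp add: \<mu>p sum_distrib_left)
    moreover have "(\<Sum>i\<in>T. \<Sum>j\<in>T. r * C * p i * p j) = r * C * \<mu>\<^sup>2"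
      unfolding \<mu>p power2_eq_square sum_product by (simp add: sum_distrib_left mult_ac)
    ultimately show ?thesis by (simp add: sum.distrib)
  qed
  finally have S2: "(\<Sum>x\<in>P. (X x)\<^sup>2) \<le> C * \<mu> + r * C * \<mu>\<^sup>2" .
  have "(\<Sum>x\<in>P. (X x - \<mu>)\<^sup>2) = (\<Sum>x\<in>P. (X x)\<^sup>2) - 2 * \<mu> * (\<Sum>x\<in>P. X x) + C * \<mu>\<^sup>2"
  proof -
    have "(X x - \<mu>)\<^sup>2 = (X x)\<^sup>2 - 2 * \<mu> * X x + \<mu>\<^sup>2" for x
      by (simp add: power2_diff)
    then show ?thesis
      by (simp only: sum.distrib sum_subtractf sum_distrib_left[symmetric] sum_constant C_def)
  qed
  also have "\<dots> \<le> C * \<mu> + (r - 1) * C * \<mu>\<^sup>2"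
    using S2 unfolding S1 by (simp add: algebra_simps power2_eq_square)
  finally have V: "(\<Sum>x\<in>P. (X x - \<mu>)\<^sup>2) \<le> C * \<mu> + (r - 1) * C * \<mu>\<^sup>2" .
  have "(\<mu> / 2)\<^sup>2 * real (card {x \<in> P. X x < \<mu> / 2}) = (\<Sum>x\<in>{x \<in> P. X x < \<mu> / 2}. (\<mu> / 2)\<^sup>2)"
    by simp
  also have "\<dots> \<le> (\<Sum>x\<in>{x \<in> P. X x < \<mu> / 2}. (X x - \<mu>)\<^sup>2)"
  proof (rule sum_mono)
    fix x assume "x \<in> {x \<in> P. X x < \<mu> / 2}"
    then have "\<mu> / 2 \<le> \<mu> - X x" by simp
    then have "(\<mu> / 2)\<^sup>2 \<le> (\<mu> - X x)\<^sup>2" using \<mu>(2) by (intro power_mono) auto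
    then show "(\<mu> / 2)\<^sup>2 \<le> (X x - \<mu>)\<^sup>2" by (simp add: power2_commute)
  qed
  also have "\<dots> \<le> (\<Sum>x\<in>P. (X x - \<mu>)\<^sup>2)"
    using P by (intro sum_mono2) auto
  also note V
  finally have "\<mu>\<^sup>2 * real (card {x \<in> P. X x < \<mu> / 2}) \<le> 4 * (C * \<mu> + (r - 1) * C * \<mu>\<^sup>2)"
    by (simp only: power_divide) simp
  also have "\<dots> = \<mu>\<^sup>2 * (4 * (1 / \<mu> + (r - 1)) * C)"
    using \<mu>(2) by (simp add: field_simps power2_eq_square)
  finally have "\<mu>\<^sup>2 * real (card {x \<in> P. X x < \<mu> / 2}) \<le> \<mu>\<^sup>2 * (4 * (1 / \<mu> + (r - 1)) * C)" .
  then have "real (card {x \<in> P. X x < \<mu> / 2}) \<le> 4 * (1 / \<mu> + (r - 1)) * C"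
    using \<mu>(2) by (simp only: mult_le_cancel_left_pos zero_less_power)
  then show ?thesis unfolding X_def C_def .
qed

text \<open>One support point is chosen in each hit box. Since all sides of a box are the same set
  \<open>B i\<close>, the chosen points increase in every coordinate simultaneously.\<close>

lemma longest_monotone_ge_card_box_hits:
  fixes T :: "nat set"
  assumes \<pi>: "\<pi> \<in> relabellings k n" and T: "finite T"
    and sep: "\<And>i j x y. i \<in> T \<Longrightarrow> j \<in> T \<Longrightarrow> i < j \<Longrightarrow> x \<in> B i \<Longrightarrow> y \<in> B j \<Longrightarrow> x < y"
  shows "card {i \<in> T. \<pi> \<in> box_hits k n A (B i)} \<le> longest_monotone k n (relabel_array k n \<pi> A)"
proof -
  define W where "W = {i \<in> T. \<pi> \<in> box_hits k n A (B i)}"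
  have finW: "finite W" using T by (simp add: W_def)
  have "\<forall>i\<in>W. \<exists>\<beta>. \<beta> \<in> support k n A \<and> (\<forall>j\<in>{1..k+1}. \<pi> j (\<beta> j) \<in> B i)"
    unfolding W_def box_hits_def by blast
  then obtain \<beta> where "\<forall>i\<in>W. \<beta> i \<in> support k n A \<and> (\<forall>j\<in>{1..k+1}. \<pi> j (\<beta> i j) \<in> B i)"
    by (rule bchoice[THEN exE])
  then have \<beta>: "\<And>i. i \<in> W \<Longrightarrow> \<beta> i \<in> support k n A"
    "\<And>i j. i \<in> W \<Longrightarrow> j \<in> {1..k+1} \<Longrightarrow> \<pi> j (\<beta> i j) \<in> B i"
    by blast+
  define s where "s = map (\<lambda>i. relabel k \<pi> (\<beta> i)) (sorted_list_of_set W)"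
  have "set s \<subseteq> support k n (relabel_array k n \<pi> A)"
    unfolding s_def support_relabel_array[OF \<pi>] using finW \<beta>(1) by auto
  moreover have "sorted_wrt (<) (map (\<lambda>\<alpha>. \<alpha> j) s)" if j: "j \<in> {1..k+1}" for j
  proof -
    have "sorted_wrt (\<lambda>i i'. relabel k \<pi> (\<beta> i) j < relabel k \<pi> (\<beta> i') j) (sorted_list_of_set W)"
    proof (rule sorted_wrt_mono_rel[OF _ strict_sorted_list_of_set])
      fix i i' assume "i \<in> set (sorted_list_of_set W)" "i' \<in> set (sorted_list_of_set W)" "i < i'"
      then have i: "i \<in> W" "i' \<in> W" "i < i'" using finW by simp_all
      then have "i \<in> T" "i' \<in> T" unfolding W_def by blast+
      from sep[OF this i(3) \<beta>(2)[OF i(1) j] \<beta>(2)[OF i(2) j]]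
      show "relabel k \<pi> (\<beta> i) j < relabel k \<pi> (\<beta> i') j"
        unfolding relabel_apply[OF j] .
    qed
    then show ?thesis by (simp add: s_def sorted_wrt_map)
  qed
  ultimately have "monotone_subsequence k n (relabel_array k n \<pi> A) s"
    unfolding monotone_subsequence_def by blast
  moreover have "length s = card W" by (simp add: s_def)
  ultimately show ?thesis unfolding W_def[symmetric] longest_monotone_ge_iff by blast
qed

subsection \<open>Lower bound\<close>

text \<open>The ratio is the product over \<open>a < s\<close> of (n - a) / (n - s - a). Each factor
  is 1 + s / (n - s - a), which is at most \<open>1 + c\<close> and hence at most
  \<open>exp c\<close>.\<close>

lemma fact_ratio_le:
  assumes s: "2 * s < n"
  shows "fact n * fact (n - 2 * s) / (fact (n - s))\<^sup>2 \<le> exp ((real s)\<^sup>2 / real (n - 2 * s))"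
proof -
  define c where "c = real s / real (n - 2 * s)"
  \<comment> \<open>Induction on the number \<open>a\<close> of factors taken into account;
    \<open>a = s\<close> is the claim with denominators cleared.\<close>
  have "fact n * fact (n - s - a) \<le> exp (real a * c) * (fact (n - a) * fact (n - s))" if "a \<le> s" for a
    using that
  proof (induction a)
    case (Suc a)
    define x y where "x = real (n - a)" and "y = real (n - s - a)"
    have "n - s - a = Suc (n - s - Suc a)" "n - a = Suc (n - Suc a)"
      using s Suc.prems by linarith+
    then have f: "(fact (n - s - a) :: real) = y * fact (n - s - Suc a)"
      "(fact (n - a) :: real) = x * fact (n - Suc a)"
      unfolding x_def y_def by (metis fact_Suc)+
    have y: "y > 0" using s Suc.prems by (simp add: y_def)
    have "x / y = 1 + real s / y"
      using s Suc.prems y by (simp add: x_def y_def field_simps of_nat_diff)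
    also have "\<dots> \<le> 1 + c"
      unfolding c_def y_def using s Suc.prems
      by (intro add_left_mono divide_left_mono mult_pos_pos) auto
    also have "\<dots> \<le> exp c" by simp
    finally have xy: "x \<le> exp c * y" using y by (simp add: field_simps)
    have "y * (fact n * fact (n - s - Suc a)) = fact n * fact (n - s - a)"
      by (simp only: f(1) mult_ac)
    also have "\<dots> \<le> exp (real a * c) * (x * (fact (n - Suc a) * fact (n - s)))"
      using Suc by (simp add: f mult_ac)
    also have "\<dots> \<le> exp (real a * c) * (exp c * y * (fact (n - Suc a) * fact (n - s)))"
      using xy by (intro mult_left_mono mult_right_mono) auto
    also have "\<dots> = y * (exp (real (Suc a) * c) * (fact (n - Suc a) * fact (n - s)))"
      by (simp add: exp_add algebra_simps)
    finally show ?case using y by (simp only: mult_le_cancel_left_pos)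
  qed simp
  from this[of s] have "fact n * fact (n - 2 * s) \<le> exp (real s * c) * (fact (n - s))\<^sup>2"
    by (simp add: power2_eq_square mult_2)
  then show ?thesis by (simp add: c_def power2_eq_square field_simps)
qed

text \<open>There are \<open>n div s\<close> blocks, and \<open>m\<close> is a lower bound for the expected number that are hit.\<close>

lemma prob_longest_monotone_less_blocks:
  assumes k: "k \<ge> 2" and s: "s \<ge> 2" "s ^ (k + 1) \<le> n"
    and m: "m = real (n div s) * (real s ^ (k + 1) / real n / 4 ^ (k + 1))"
  shows "measure_pmf.prob (random_hd_permutation k n) {A. real (longest_monotone k n A) < m / 2}
    \<le> 4 * (1 / m + (exp (real (k + 1) * (2 / real s)) - 1))"
proof (rule prob_random_hd_permutation_le)
  fix A assume A: "A \<in> hd_permutations k n"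
  \<comment> \<open>Here \<open>k \<ge> 2\<close> enters: \<open>s ^ 3 \<le> n\<close> makes the
    exponent in \<open>fact_ratio_le\<close> of order 1 / s.\<close>
  have "s ^ 3 \<le> s ^ (k + 1)" using k s(1) by (intro power_increasing) auto
  then have s3: "s ^ 3 \<le> n" using s(2) by simp
  have "2 * 2 * s \<le> s * s * s" using s(1) by (intro mult_le_mono) auto
  then have s4: "4 * s \<le> n" using s3 unfolding power3_eq_cube by linarith
  define P where "P = relabellings k n"
  define r where "r = exp (real (k + 1) * (2 / real s))"
  \<comment> \<open>Consecutive intervals of length \<open>s\<close> starting at 1; fewer than
    \<open>s\<close> values at the top of \<open>{1..n}\<close> are left over.\<close>
  define I where "I i = {i * s + 1..(i + 1) * s}" for i
  define T where "T = {..<n div s}"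
  define Q where "Q i = box_hits k n A (I i)" for i
  define \<mu> where "\<mu> = (\<Sum>i\<in>T. real (card (Q i)) / card P)"
  have P: "finite P" "P \<noteq> {}" "real (card P) > 0"
    using card_relabellings[of k n] finite_relabellings[of k n] unfolding P_def by fastforce+
  have m0: "m > 0" using s s4 by (simp add: m div_greater_zero_iff)
  have cI: "card (I i) = s" for i by (simp add: I_def)
  have IN: "I i \<subseteq> {1..n}" if "i \<in> T" for i
  proof -
    have "i + 1 \<le> n div s" using that by (simp add: T_def)
    then have "(i + 1) * s \<le> n div s * s" by (rule mult_le_mono1)
    also have "\<dots> \<le> n" by simp
    finally show ?thesis by (auto simp: I_def)
  qed
  have sep: "x < y" if "i < j" "x \<in> I i" "y \<in> I j" for i j x y :: nat
  proof -
    have "(i + 1) * s \<le> j * s" using that(1) by (intro mult_le_mono1) simp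
    then show ?thesis using that(2,3) by (simp add: I_def)
  qed
  have disj: "I i \<inter> I j = {}" if "i \<noteq> j" for i j
    using that sep[of i j] sep[of j i] by (cases i j rule: linorder_cases) blast+
  have "m = (\<Sum>i\<in>T. real s ^ (k + 1) / real n / 4 ^ (k + 1))"
    by (simp add: m T_def)
  also have "\<dots> \<le> \<mu>"
    unfolding \<mu>_def
  proof (rule sum_mono)
    fix i assume "i \<in> T"
    have "real (card (I i)) ^ (k + 1) / real n / 4 ^ (k + 1) * card (relabellings k n) \<le> real (card (Q i))"
      unfolding Q_def using s s4 cI by (intro card_box_hits_ge[OF A _ IN[OF \<open>i \<in> T\<close>]]) auto
    then show "real s ^ (k + 1) / real n / 4 ^ (k + 1) \<le> real (card (Q i)) / card P"
      unfolding cI P_def[symmetric] using P(3) by (simp only: pos_le_divide_eq)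
  qed
  finally have m\<mu>: "m \<le> \<mu>" .
  have ratio: "(fact n * fact (n - 2 * s) / (fact (n - s))\<^sup>2) ^ (k + 1) \<le> r"
  proof -
    \<comment> \<open>As \<open>4 * s \<le> n\<close>, the denominator is at least n / 2, hence at
      least half of \<open>s ^ 3\<close>.\<close>
    have "(real s)\<^sup>2 / real (n - 2 * s) \<le> (real s)\<^sup>2 / (real s ^ 3 / 2)"
    proof (rule divide_left_mono)
      have "2 * real (n - 2 * s) \<ge> real n" using s4 by (simp add: of_nat_diff)
      moreover have "real n \<ge> real s ^ 3" using s3 unfolding of_nat_power[symmetric] of_nat_le_iff .
      ultimately show "real s ^ 3 / 2 \<le> real (n - 2 * s)" by linarith
    qed (use s s4 in auto)
    also have "\<dots> = 2 / real s" using s by (simp add: power2_eq_square power3_eq_cube)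
    finally have "(real s)\<^sup>2 / real (n - 2 * s) \<le> 2 / real s" .
    moreover have "2 * s < n" using s s4 by linarith
    ultimately have "fact n * fact (n - 2 * s) / (fact (n - s))\<^sup>2 \<le> exp (2 / real s)"
      using fact_ratio_le[of s n] by (meson exp_le_cancel_iff order_trans)
    then have "(fact n * fact (n - 2 * s) / (fact (n - s))\<^sup>2) ^ (k + 1) \<le> exp (2 / real s) ^ (k + 1)"
      by (intro power_mono) auto
    also have "\<dots> = r" unfolding r_def by (rule exp_of_nat_mult[symmetric])
    finally show ?thesis .
  qed
  have pair: "real (card (Q i \<inter> Q j)) * card P \<le> r * card (Q i) * card (Q j)"
    if "i \<in> T" "j \<in> T" "i \<noteq> j" for i j
  proof -
    have "real (card (Q i \<inter> Q j)) * card P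
        \<le> (fact n * fact (n - 2 * s) / (fact (n - s))\<^sup>2) ^ (k + 1) * card (Q i) * card (Q j)"
      unfolding Q_def P_def using that by (intro card_box_hits_Int_le IN cI disj)
    also have "\<dots> \<le> r * card (Q i) * card (Q j)"
      using ratio by (intro mult_right_mono) auto
    finally show ?thesis .
  qed
  have "{\<pi> \<in> P. real (longest_monotone k n (relabel_array k n \<pi> A)) < m / 2}
      \<subseteq> {\<pi> \<in> P. real (card {i \<in> T. \<pi> \<in> Q i}) < \<mu> / 2}"
  proof
    fix \<pi> assume "\<pi> \<in> {\<pi> \<in> P. real (longest_monotone k n (relabel_array k n \<pi> A)) < m / 2}"
    then have \<pi>: "\<pi> \<in> P" "real (longest_monotone k n (relabel_array k n \<pi> A)) < m / 2" by auto
    have "card {i \<in> T. \<pi> \<in> Q i} \<le> longest_monotone k n (relabel_array k n \<pi> A)"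
      unfolding Q_def
      by (rule longest_monotone_ge_card_box_hits[OF \<pi>(1)[unfolded P_def] _ sep]) (simp add: T_def)
    then have "real (card {i \<in> T. \<pi> \<in> Q i}) < \<mu> / 2" using \<pi>(2) m\<mu> by linarith
    then show "\<pi> \<in> {\<pi> \<in> P. real (card {i \<in> T. \<pi> \<in> Q i}) < \<mu> / 2}" using \<pi>(1) by blast
  qed
  then have "real (card {\<pi> \<in> P. real (longest_monotone k n (relabel_array k n \<pi> A)) < m / 2})
      \<le> real (card {\<pi> \<in> P. real (card {i \<in> T. \<pi> \<in> Q i}) < \<mu> / 2})"
    using P(1) by (intro of_nat_mono card_mono) auto
  also have "\<dots> \<le> 4 * (1 / \<mu> + (r - 1)) * card P"
  proof (rule card_few_hits_le[OF P(1,2) _ _ pair _ \<mu>_def])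
    show "\<mu> > 0" using m0 m\<mu> by linarith
    show "Q i \<subseteq> P" for i by (auto simp: Q_def P_def box_hits_def)
  qed (auto simp: T_def r_def)
  \<comment> \<open>The error bound decreases in the mean, so the explicit lower bound
    \<open>m\<close> may replace \<open>\<mu>\<close>.\<close>
  also have "\<dots> \<le> 4 * (1 / m + (r - 1)) * card P"
    using m0 m\<mu> by (intro mult_right_mono mult_left_mono add_right_mono divide_left_mono) auto
  finally show "real (card {\<pi> \<in> relabellings k n.
      real (longest_monotone k n (relabel_array k n \<pi> A)) < m / 2})
    \<le> 4 * (1 / m + (exp (real (k + 1) * (2 / real s)) - 1)) * card (relabellings k n)"
    unfolding P_def r_def .
qed

text \<open>The side \<open>s\<close> is \<open>n\<close> to the power 1 / (k + 1), rounded down.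
  There are at least \<open>N / 2\<close> blocks, each hit with probability at least
  \<open>1 / 8 ^ (k + 1)\<close>; half of the resulting mean gives the constant
  \<open>1 / (4 * 8 ^ (k + 1))\<close>. The assumption on \<open>n\<close> ensures
  \<open>s \<ge> 2\<close>.\<close>

lemma prob_longest_monotone_less:
  assumes k: "k \<ge> 2" and n: "n \<ge> 2 ^ (k + 1)"
  shows "measure_pmf.prob (random_hd_permutation k n)
      {A. real (longest_monotone k n A) < 1 / (4 * 8 ^ (k + 1)) * real n powr (real k / real (k + 1))}
    \<le> 4 * (2 * 8 ^ (k + 1) / real n powr (real k / real (k + 1))
        + (exp (real (k + 1) * (4 / real n powr (1 / real (k + 1)))) - 1))"
proof -
  define N where "N = real n powr (real k / real (k + 1))"
  define x where "x = real n powr (1 / real (k + 1))"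
  define s where "s = nat \<lfloor>x\<rfloor>"
  have "(2::nat) ^ (k + 1) \<ge> 1" by (rule one_le_power) simp
  then have n1: "n \<ge> 1" using n by linarith
  have xn: "x ^ (k + 1) = real n"
    unfolding x_def using n1 by (subst powr_power) auto
  have xN: "x * N = real n"
  proof -
    have "1 / real (k + 1) + real k / real (k + 1) = 1" by (simp add: add_divide_distrib[symmetric])
    then show ?thesis unfolding x_def N_def powr_add[symmetric] using n1 by simp
  qed
  have x0: "x > 0" "N > 0" using n1 by (simp_all add: x_def N_def)
  have "real (2 ^ (k + 1)) \<le> real n" using n by (rule of_nat_mono)
  then have "(2::real) ^ (k + 1) \<le> x ^ (k + 1)" using xn by simp
  then have x2: "x \<ge> 2" using x0 power_le_imp_le_base[of 2 k x] by simp
  have sx: "real s \<le> x" "x \<le> 2 * real s" "s \<ge> 2"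
    using x2 unfolding s_def by linarith+
  have "real (s ^ (k + 1)) \<le> x ^ (k + 1)"
    unfolding of_nat_power using sx(1) by (intro power_mono) auto
  then have sn: "s ^ (k + 1) \<le> n" unfolding xn of_nat_le_iff .
  define m where "m = real (n div s) * (real s ^ (k + 1) / real n / 4 ^ (k + 1))"
  \<comment> \<open>Since \<open>s \<le> x\<close> and \<open>x * N = n\<close>, the quotient before
    rounding is at least \<open>N\<close>. Rounding down loses at most half of it, because
    \<open>n div s\<close> is at least 1.\<close>
  have "N / 2 \<le> real (n div s)"
  proof -
    have "s ^ 1 \<le> s ^ (k + 1)" using sx(3) by (intro power_increasing) auto
    from order_trans[OF this sn] have "s \<le> n" by simp
    then have "1 \<le> n div s" using sx(3) by (simp add: Suc_le_eq div_greater_zero_iff)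
    then have "(n div s + 1) * s \<le> 2 * (n div s) * s" by (intro mult_le_mono1) simp
    moreover have "n < s + (n div s) * s" using sx(3) by (intro dividend_less_div_times) simp
    moreover have "(n div s + 1) * s = s + (n div s) * s" by simp
    ultimately have "n \<le> 2 * (n div s) * s" by linarith
    then have "real n \<le> real (2 * (n div s) * s)" by (rule of_nat_mono)
    also have "\<dots> = 2 * real (n div s) * real s" by simp
    also have "\<dots> \<le> 2 * real (n div s) * x" using sx(1) by (intro mult_left_mono) auto
    finally have "x * N \<le> x * (2 * real (n div s))" using xN by (simp add: mult_ac)
    then have "N \<le> 2 * real (n div s)" using x0 by (simp only: mult_le_cancel_left_pos)
    then show ?thesis by linarith
  qed
  \<comment> \<open>8 is 2 times 4: the 2 comes from rounding, as \<open>x \<le> 2 * s\<close>, and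
    the 4 from the second moment bound.\<close>
  moreover have "1 / 8 ^ (k + 1) \<le> real s ^ (k + 1) / real n / 4 ^ (k + 1)"
  proof -
    have "(x / 2) ^ (k + 1) \<le> real s ^ (k + 1)" using sx(2) x0 by (intro power_mono) auto
    then have "real n / 2 ^ (k + 1) \<le> real s ^ (k + 1)" by (simp only: power_divide xn)
    then have "1 / 2 ^ (k + 1) \<le> real s ^ (k + 1) / real n"
      using n1 by (simp add: field_simps)
    then have "1 / 2 ^ (k + 1) / 4 ^ (k + 1) \<le> real s ^ (k + 1) / real n / 4 ^ (k + 1)"
      by (rule divide_right_mono) simp
    moreover have "(2::real) ^ (k + 1) * 4 ^ (k + 1) = 8 ^ (k + 1)"
      unfolding power_mult_distrib[symmetric] by simp
    ultimately show ?thesis by (simp only: divide_divide_eq_left)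
  qed
  ultimately have "N / 2 * (1 / 8 ^ (k + 1)) \<le> m"
    unfolding m_def using x0 by (intro mult_mono) auto
  then have mN: "N / (2 * 8 ^ (k + 1)) \<le> m" by simp
  have m0: "N / (2 * 8 ^ (k + 1)) > 0" using x0 by simp
  have "measure_pmf.prob (random_hd_permutation k n)
        {A. real (longest_monotone k n A) < 1 / (4 * 8 ^ (k + 1)) * N}
      \<le> measure_pmf.prob (random_hd_permutation k n) {A. real (longest_monotone k n A) < m / 2}"
    using mN by (intro measure_pmf.finite_measure_mono) auto
  also have "\<dots> \<le> 4 * (1 / m + (exp (real (k + 1) * (2 / real s)) - 1))"
    by (rule prob_longest_monotone_less_blocks[OF k sx(3) sn m_def])
  also have "\<dots> \<le> 4 * (2 * 8 ^ (k + 1) / N + (exp (real (k + 1) * (4 / x)) - 1))"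
  proof -
    have "1 / m \<le> 1 / (N / (2 * 8 ^ (k + 1)))"
      using mN m0 by (intro divide_left_mono mult_pos_pos) auto
    then have m: "1 / m \<le> 2 * 8 ^ (k + 1) / N" by (simp only: divide_divide_eq_right mult_1)
    have "2 / real s \<le> 4 / x" using sx x0 by (simp add: field_simps)
    then have "real (k + 1) * (2 / real s) \<le> real (k + 1) * (4 / x)"
      by (rule mult_left_mono) simp
    then have "exp (real (k + 1) * (2 / real s)) \<le> exp (real (k + 1) * (4 / x))"
      by (simp only: exp_le_cancel_iff)
    with m show ?thesis by (intro mult_left_mono add_mono diff_right_mono) simp_all
  qed
  finally show ?thesis unfolding N_def x_def .
qed

text \<open>For \<open>k = 1\<close> the probability is 0 as soon as \<open>n \<ge> 1\<close>, by
  \<open>longest_monotone_square_ge\<close>. For \<open>k \<ge> 2\<close> both error terms vanish,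
  because the number of blocks and their side tend to infinity.\<close>

lemma prob_longest_monotone_less_tendsto:
  assumes k: "k \<ge> 1"
  shows "(\<lambda>n. measure_pmf.prob (random_hd_permutation k n)
      {A. real (longest_monotone k n A) < 1 / (4 * 8 ^ (k + 1)) * real n powr (real k / real (k + 1))})
    \<longlonglongrightarrow> 0"
proof (cases "k = 1")
  case True
  have "measure_pmf.prob (random_hd_permutation k n)
      {A. real (longest_monotone k n A) < 1 / (4 * 8 ^ (k + 1)) * real n powr (real k / real (k + 1))} = 0"
    if n: "n \<ge> 1" for n
  proof -
    have "measure_pmf.prob (random_hd_permutation k n)
        {A. real (longest_monotone k n A) < 1 / (4 * 8 ^ (k + 1)) * real n powr (real k / real (k + 1))} \<le> 0"
    proof (rule prob_random_hd_permutation_le)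
      fix A assume A: "A \<in> hd_permutations k n"
      have "\<not> real (longest_monotone k n (relabel_array k n \<pi> A))
          < 1 / (4 * 8 ^ (k + 1)) * real n powr (real k / real (k + 1))"
        if \<pi>: "\<pi> \<in> relabellings k n" for \<pi>
      proof -
        let ?h = "longest_monotone k n (relabel_array k n \<pi> A)"
        have "n \<le> ?h\<^sup>2"
          using longest_monotone_square_ge[OF _ n] relabel_array_in_hd_permutations[OF \<pi> A]
          unfolding True by blast
        then have "real n \<le> (real ?h)\<^sup>2" unfolding of_nat_power[symmetric] of_nat_le_iff .
        then have "sqrt (real n) \<le> real ?h" by (rule real_le_lsqrt[rotated]) auto
        moreover have "real n powr (real k / real (k + 1)) = sqrt (real n)"
          using True by (simp add: powr_half_sqrt)
        moreover have "1 / (4 * 8 ^ (k + 1)) * sqrt (real n) \<le> 1 * sqrt (real n)"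
          using True by (intro mult_right_mono) auto
        ultimately show ?thesis by simp
      qed
      then have "{\<pi> \<in> relabellings k n. real (longest_monotone k n (relabel_array k n \<pi> A))
          < 1 / (4 * 8 ^ (k + 1)) * real n powr (real k / real (k + 1))} = {}" by blast
      then show "real (card {\<pi> \<in> relabellings k n. real (longest_monotone k n (relabel_array k n \<pi> A))
          < 1 / (4 * 8 ^ (k + 1)) * real n powr (real k / real (k + 1))}) \<le> 0 * real (card (relabellings k n))"
        by (simp only: card.empty of_nat_0 mult_zero_left order_refl)
    qed
    then show ?thesis by (simp add: measure_le_0_iff)
  qed
  then show ?thesis
    by (intro tendsto_eventually eventually_sequentiallyI)
next
  case False
  then have k2: "k \<ge> 2" using k by simp
  define d c where "d = real (k + 1)" and "c = 2 * (8::real) ^ (k + 1)"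
  have d: "d > 0" "real k > 0" using k by (simp_all add: d_def)
  have "(\<lambda>n. 4 * (c / real n powr (real k / d) + (exp (d * (4 / real n powr (1 / d))) - 1)))
      \<longlonglongrightarrow> 4 * (0 + (exp (d * 0) - 1))"
  proof (intro tendsto_intros)
    show "(\<lambda>n. c / real n powr (real k / d)) \<longlonglongrightarrow> 0"
      using d by real_asymp
    show "(\<lambda>n. 4 / real n powr (1 / d)) \<longlonglongrightarrow> 0"
      using d by real_asymp
  qed
  then have lim: "(\<lambda>n. 4 * (c / real n powr (real k / d) + (exp (d * (4 / real n powr (1 / d))) - 1)))
      \<longlonglongrightarrow> 0" by simp
  show ?thesis
  proof (rule tendsto_sandwich[OF _ _ tendsto_const lim])
    show "\<forall>\<^sub>F n in sequentially. measure_pmf.prob (random_hd_permutation k n)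
        {A. real (longest_monotone k n A) < 1 / (4 * 8 ^ (k + 1)) * real n powr (real k / real (k + 1))}
        \<le> 4 * (c / real n powr (real k / d) + (exp (d * (4 / real n powr (1 / d))) - 1))"
      unfolding c_def d_def
      by (rule eventually_mono[OF eventually_ge_at_top]) (rule prob_longest_monotone_less[OF k2])
  qed simp
qed

section \<open>Expectation and concentration\<close>

lemma longest_monotone_le: "longest_monotone k n A \<le> n"
  using longest_monotone_ge_iff[THEN iffD1, OF order_refl] length_monotone_subsequence_le by metis

lemma integrable_random_hd_permutation:
  "integrable (measure_pmf (random_hd_permutation k n)) (f :: _ \<Rightarrow> real)"
  unfolding random_hd_permutation_def
  using hd_permutations_nonempty finite_hd_permutations by (intro integrable_measure_pmf_finite) simp

theorem theorem5:
  fixes k :: nat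
  assumes "k \<ge> 1"
  shows "(\<lambda>n. measure_pmf.expectation (random_hd_permutation k n)
              (\<lambda>A. real (longest_monotone k n A)))
            \<in> \<Theta>(\<lambda>n. real n powr (real k / real (k + 1)))
       \<and> (\<exists>a b :: real. 0 < a \<and> a < b \<and>
            (\<lambda>n. measure_pmf.prob (random_hd_permutation k n)
                {A. a * real n powr (real k / real (k + 1)) \<le> real (longest_monotone k n A)
                  \<and> real (longest_monotone k n A) \<le> b * real n powr (real k / real (k + 1))})
              \<longlonglongrightarrow> 1)"
proof -
  define N where "N n = real n powr (real k / real (k + 1))" for n
  define H where "H n A = real (longest_monotone k n A)" for n A
  define \<mu> where "\<mu> n = random_hd_permutation k n" for n
  define a :: real where "a = 1 / (4 * 8 ^ (k + 1))"
  define lo where "lo n = measure_pmf.prob (\<mu> n) {A. H n A < a * N n}" for n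
  define hi where "hi n = measure_pmf.prob (\<mu> n) {A. 6 * N n < H n A}" for n
  have a: "0 < a" "a < 6"
  proof -
    have "(1::real) \<le> 8 ^ (k + 1)" by (rule one_le_power) simp
    then have "a \<le> 1" by (simp add: a_def)
    then show "a < 6" by linarith
  qed (simp add: a_def)
  have lo: "lo \<longlonglongrightarrow> 0"
    using prob_longest_monotone_less_tendsto[OF assms]
    unfolding lo_def[abs_def] H_def N_def a_def \<mu>_def .
  have hi: "hi n \<le> 2 ^ (k + 1) / real n" if "n \<ge> 1" for n
    using prob_longest_monotone_gt[OF assms that] unfolding hi_def H_def N_def \<mu>_def .
  have hi0: "hi \<longlonglongrightarrow> 0"
  proof (rule tendsto_sandwich[OF _ _ tendsto_const])
    show "(\<lambda>n. 2 ^ (k + 1) / real n) \<longlonglongrightarrow> 0" by real_asymp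
    show "\<forall>\<^sub>F n in sequentially. hi n \<le> 2 ^ (k + 1) / real n"
      using hi by (intro eventually_sequentiallyI)
  qed (simp add: hi_def)
  have N1: "N n \<ge> 1" if "n \<ge> 1" for n
    using that by (simp add: N_def ge_one_powr_ge_zero)

  define E where "E n = measure_pmf.expectation (\<mu> n) (H n)" for n
  have int: "integrable (measure_pmf (\<mu> n)) f" for n and f :: "_ \<Rightarrow> real"
    unfolding \<mu>_def by (rule integrable_random_hd_permutation)
  \<comment> \<open>On the exceptional event \<open>H\<close> is bounded by \<open>n\<close>. The 1
    / n decay of \<open>hi\<close> makes this contribution at most the constant
    \<open>2 ^ (k + 1)\<close>, which is absorbed since \<open>N n \<ge> 1\<close>.\<close>
  have E_upper: "E n \<le> (6 + 2 ^ (k + 1)) * N n" if n: "n \<ge> 1" for n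
  proof -
    have "E n \<le> measure_pmf.expectation (\<mu> n) (\<lambda>A. 6 * N n + real n * indicator {A. 6 * N n < H n A} A)"
      unfolding E_def
    proof (rule integral_mono[OF int int])
      fix A
      show "H n A \<le> 6 * N n + real n * indicator {A. 6 * N n < H n A} A"
        using longest_monotone_le[of k n A] N1[OF n] by (auto simp: H_def indicator_def)
    qed
    also have "\<dots> = 6 * N n + real n * hi n"
      unfolding hi_def by (subst Bochner_Integration.integral_add[OF int int]) simp
    also have "\<dots> \<le> 6 * N n + 2 ^ (k + 1)"
      using hi[OF n] n by (simp add: field_simps)
    also have "\<dots> \<le> 6 * N n + 2 ^ (k + 1) * N n" using N1[OF n] by simp
    finally show ?thesis by (simp add: algebra_simps)
  qed
  \<comment> \<open>Markov's inequality at the threshold \<open>a * N n\<close>.\<close>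
  have E_lower: "a * N n * (1 - lo n) \<le> E n" for n
  proof -
    have "1 - lo n = measure_pmf.prob (\<mu> n) {A. a * N n \<le> H n A}"
      unfolding lo_def using measure_pmf.prob_compl[of "{A. H n A < a * N n}" "\<mu> n"]
      by (simp add: Compl_eq_Diff_UNIV[symmetric] Collect_neg_eq[symmetric] not_less)
    then have "a * N n * (1 - lo n)
        = measure_pmf.expectation (\<mu> n) (\<lambda>A. a * N n * indicator {A. a * N n \<le> H n A} A)"
      by simp
    also have "\<dots> \<le> E n"
      unfolding E_def
      by (rule integral_mono[OF int int]) (auto simp: indicator_def H_def)
    finally show ?thesis .
  qed
  have "E \<in> \<Theta>(N)"
  proof (rule bigthetaI')
    \<comment> \<open>Once the lower tail is below 1 / 2, \<open>E_lower\<close> gives the constant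
      \<open>a / 2\<close>.\<close>
    have "\<forall>\<^sub>F n in sequentially. lo n < 1 / 2"
      by (rule order_tendstoD(2)[OF lo]) simp
    then show "\<forall>\<^sub>F n in sequentially. a / 2 * norm (N n) \<le> norm (E n)
        \<and> norm (E n) \<le> (6 + 2 ^ (k + 1)) * norm (N n)"
      using eventually_ge_at_top[of 1]
    proof eventually_elim
      case (elim n)
      have N: "N n > 0" using N1[OF elim(2)] by simp
      have "a * N n * (1 / 2) \<le> a * N n * (1 - lo n)"
        using elim a N by (intro mult_left_mono) auto
      then have "a / 2 * N n \<le> E n" using E_lower[of n] by simp
      moreover have "E n \<ge> 0" unfolding E_def H_def by simp
      ultimately show ?case using E_upper[OF elim(2)] N by simp
    qed
  qed (use a in \<open>auto intro: add_pos_pos\<close>)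
  moreover have "(\<lambda>n. measure_pmf.prob (\<mu> n) {A. a * N n \<le> H n A \<and> H n A \<le> 6 * N n}) \<longlonglongrightarrow> 1"
  proof (rule tendsto_sandwich[OF _ _ _ tendsto_const])
    \<comment> \<open>The complement of the window is the union of the two tail events.\<close>
    have "1 - (lo n + hi n) \<le> measure_pmf.prob (\<mu> n) {A. a * N n \<le> H n A \<and> H n A \<le> 6 * N n}" for n
    proof -
      let ?X = "{A. a * N n \<le> H n A \<and> H n A \<le> 6 * N n}"
      have "1 - measure_pmf.prob (\<mu> n) ?X = measure_pmf.prob (\<mu> n) (UNIV - ?X)"
        using measure_pmf.prob_compl[of ?X "\<mu> n"] by simp
      also have "UNIV - ?X = {A. H n A < a * N n} \<union> {A. 6 * N n < H n A}" by auto
      also have "measure_pmf.prob (\<mu> n) \<dots> \<le> lo n + hi n"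
        unfolding lo_def hi_def by (rule measure_Un_le) auto
      finally show ?thesis by linarith
    qed
    then show "\<forall>\<^sub>F n in sequentially. 1 - (lo n + hi n)
        \<le> measure_pmf.prob (\<mu> n) {A. a * N n \<le> H n A \<and> H n A \<le> 6 * N n}" by simp
    show "(\<lambda>n. 1 - (lo n + hi n)) \<longlonglongrightarrow> 1"
      using tendsto_diff[OF tendsto_const tendsto_add[OF lo hi0]] by simp
  qed simp
  ultimately show ?thesis
    using a unfolding E_def[abs_def] N_def[abs_def] H_def[abs_def] \<mu>_def by blast
qed

end
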